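(* If $a=1$ and $\gamma=0$, then the system $$u_{tt}+aAu+A^{\gamma}u_t+\alpha y_t=0,\qquad y_{tt}+Ay-\alpha u_t=0$$ is exponentially stable; that is, there exist constants $M>0$ and $\epsilon>0$ such that $$\|e^{t\mathcal{A}}U_0\|_{\mathcal{H}}\leq M e^{-\epsilon t}\|U_0\|_{\mathcal{H}}\qquad \forall\, t>0,\ \forall\, U_0\in\mathcal{H}.$$
   Context: $H$ is an infinite-dimensional separable complex Hilbert space with norm $\|\cdot\|$; $A$ is a self-adjoint, coercive operator in $H$ with compact resolvent and simple spectrum; fractional powers of $A$ are defined by spectral calculus. The parameters satisfy $a>0$, $\gamma\le 0$, $\alpha\in\mathbb{R}\setminus\{0\}$. The energy space is $\mathcal{H}=D(A^{1/2})\times H\times D(A^{1/2})\times H$ with norm $\|(u,v,y,z)\|_{\mathcal{H}}^2=a\|A^{1/2}u\|^2+\|A^{1/2}y\|^2+\|v\|^2+\|z\|^2$. The operator $\mathcal{A}$ has domain $D(\mathcal{A})=\{(u,v,y,z)\in\mathcal{H}:\ v,z\in D(A^{1/2}),\ u,y\in D(A)\}$ and acts by $\mathcal{A}(u,v,y,z)=(v,\,-aAu-A^{\gamma}v-\alpha z,\,z,\,-Ay+\alpha v)$. It is maximal dissipative and generates a $C_0$-semigroup of contractions $(e^{t\mathcal{A}})_{t\ge0}$ on $\mathcal{H}$; the system is the evolution equation $U_t=\mathcal{A}U$, $U(0)=U_0$, with $U=(u,u_t,y,y_t)$. *)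

theory Defs
  imports "HOL-Analysis.Analysis"
begin

section \<open>Complex Hilbert spaces\<close>

text \<open>HOL-Analysis has real inner product spaces only. A complex Hilbert space is presented
  here as a complete real inner product space with a compatible complex scalar multiplication
  and a Hermitian form whose real part is the real inner product; the norm, metric and topology
  are thus those of the library.\<close>

class complex_vector = real_vector +
  fixes scaleC :: "complex \<Rightarrow> 'a \<Rightarrow> 'a" (infixr "*\<^sub>C" 75)
  assumes scaleC_add_right: "c *\<^sub>C (x + y) = c *\<^sub>C x + c *\<^sub>C y"
    and scaleC_add_left: "(c + d) *\<^sub>C x = c *\<^sub>C x + d *\<^sub>C x"
    and scaleC_scaleC: "c *\<^sub>C (d *\<^sub>C x) = (c * d) *\<^sub>C x"
    and scaleC_of_real: "complex_of_real r *\<^sub>C x = r *\<^sub>R x"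

global_interpretation complex_vector:
  vector_space "scaleC :: complex \<Rightarrow> 'a \<Rightarrow> 'a::complex_vector"
  defines csubspace = complex_vector.subspace
    and cspan = complex_vector.span
    and cdim = complex_vector.dim
  by unfold_locales
    (use scaleC_of_real[of 1] in \<open>simp_all add: scaleC_add_right scaleC_add_left scaleC_scaleC\<close>)

instantiation prod :: (complex_vector, complex_vector) complex_vector
begin

definition scaleC_prod_def: "c *\<^sub>C p = (c *\<^sub>C fst p, c *\<^sub>C snd p)"

instance
  by standard
    (simp_all add: scaleC_prod_def scaleC_add_right scaleC_add_left scaleC_scaleC scaleC_of_real
      prod_eq_iff)

end

text \<open>The form is linear in the first and conjugate-linear in the second argument.\<close>

class complex_hilbert = complex_vector + real_inner + complete_space +
  fixes cinner :: "'a \<Rightarrow> 'a \<Rightarrow> complex"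
  assumes cinner_commute: "cinner x y = cnj (cinner y x)"
    and cinner_add_left: "cinner (x + y) z = cinner x z + cinner y z"
    and cinner_scaleC_left: "cinner (c *\<^sub>C x) y = c * cinner x y"
    and Re_cinner: "Re (cinner x y) = inner x y"

definition clinear_on :: "'a::complex_vector set \<Rightarrow> ('a \<Rightarrow> 'b::complex_vector) \<Rightarrow> bool" where
  "clinear_on X f \<longleftrightarrow> csubspace X \<and>
     (\<forall>x\<in>X. \<forall>y\<in>X. f (x + y) = f x + f y) \<and> (\<forall>c. \<forall>x\<in>X. f (c *\<^sub>C x) = c *\<^sub>C f x)"


section \<open>Unbounded operators\<close>

text \<open>An operator with domain \<open>D\<close> is a pair \<open>D A\<close>; the values of the function \<open>A\<close> outside
  \<open>D\<close> are irrelevant.\<close>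

definition adjoint_graph ::
    "'h::complex_hilbert set \<Rightarrow> ('h \<Rightarrow> 'h) \<Rightarrow> ('h \<times> 'h) set" where
  "adjoint_graph D A = {(y, z). \<forall>x\<in>D. cinner (A x) y = cinner x z}"

definition self_adjoint :: "'h::complex_hilbert set \<Rightarrow> ('h \<Rightarrow> 'h) \<Rightarrow> bool" where
  "self_adjoint D A \<longleftrightarrow>
     clinear_on D A \<and> closure D = UNIV \<and> adjoint_graph D A = (\<lambda>x. (x, A x)) ` D"

definition coercive :: "'h::complex_hilbert set \<Rightarrow> ('h \<Rightarrow> 'h) \<Rightarrow> bool" where
  "coercive D A \<longleftrightarrow> (\<exists>c>0. \<forall>x\<in>D. Re (cinner (A x) x) \<ge> c * (norm x)\<^sup>2)"

definition resolvent ::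
    "'h::complex_hilbert set \<Rightarrow> ('h \<Rightarrow> 'h) \<Rightarrow> complex \<Rightarrow> 'h \<Rightarrow> 'h" where
  "resolvent D A \<mu> = inv_into D (\<lambda>x. A x - \<mu> *\<^sub>C x)"

definition resolvent_set :: "'h::complex_hilbert set \<Rightarrow> ('h \<Rightarrow> 'h) \<Rightarrow> complex set" where
  "resolvent_set D A =
     {\<mu>. bij_betw (\<lambda>x. A x - \<mu> *\<^sub>C x) D UNIV \<and> bounded_linear (resolvent D A \<mu>)}"

definition op_spectrum :: "'h::complex_hilbert set \<Rightarrow> ('h \<Rightarrow> 'h) \<Rightarrow> complex set" where
  "op_spectrum D A = - resolvent_set D A"

definition compact_operator :: "('h::complex_hilbert \<Rightarrow> 'h) \<Rightarrow> bool" where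
  "compact_operator K \<longleftrightarrow> bounded_linear K \<and> (\<forall>S. bounded S \<longrightarrow> compact (closure (K ` S)))"

definition compact_resolvent :: "'h::complex_hilbert set \<Rightarrow> ('h \<Rightarrow> 'h) \<Rightarrow> bool" where
  "compact_resolvent D A \<longleftrightarrow> (\<exists>\<mu>\<in>resolvent_set D A. compact_operator (resolvent D A \<mu>))"

definition eigenspace ::
    "'h::complex_hilbert set \<Rightarrow> ('h \<Rightarrow> 'h) \<Rightarrow> complex \<Rightarrow> 'h set" where
  "eigenspace D A \<mu> = {x\<in>D. A x = \<mu> *\<^sub>C x}"

text \<open>The operators concerned have compact resolvent, so that the spectrum is discrete;
  it is simple if it consists of eigenvalues of multiplicity one.\<close>

definition simple_spectrum :: "'h::complex_hilbert set \<Rightarrow> ('h \<Rightarrow> 'h) \<Rightarrow> bool" where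
  "simple_spectrum D A \<longleftrightarrow> (\<forall>\<mu>\<in>op_spectrum D A. cdim (eigenspace D A \<mu>) = 1)"


section \<open>Fractional powers\<close>

text \<open>For a self-adjoint operator with compact resolvent the spectral measure is the sum of the
  orthogonal projections \<open>P\<^sub>l\<close> onto the eigenspaces, and the spectral calculus
  \<open>f(A) = \<integral> f(l) dE(l)\<close> reads \<open>f(A) x = \<Sum>\<^sub>l f(l) P\<^sub>l x\<close> on the set of all \<open>x\<close> with
  \<open>\<Sum>\<^sub>l |f(l)|\<^sup>2 \<parallel>P\<^sub>l x\<parallel>\<^sup>2 < \<infinity>\<close>. The eigenvalues are real, and positive if the operator is
  coercive.\<close>

definition eigenvalues :: "'h::complex_hilbert set \<Rightarrow> ('h \<Rightarrow> 'h) \<Rightarrow> real set" where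
  "eigenvalues D A = {l. \<exists>x\<in>eigenspace D A (complex_of_real l). x \<noteq> 0}"

definition eigenproj ::
    "'h::complex_hilbert set \<Rightarrow> ('h \<Rightarrow> 'h) \<Rightarrow> real \<Rightarrow> 'h \<Rightarrow> 'h" where
  "eigenproj D A l x = (THE p. p \<in> eigenspace D A (complex_of_real l) \<and>
     (\<forall>e\<in>eigenspace D A (complex_of_real l). cinner (x - p) e = 0))"

definition frac_dom :: "'h::complex_hilbert set \<Rightarrow> ('h \<Rightarrow> 'h) \<Rightarrow> real \<Rightarrow> 'h set" where
  "frac_dom D A s =
     {x. (\<lambda>l. (l powr s)\<^sup>2 * (norm (eigenproj D A l x))\<^sup>2) summable_on eigenvalues D A}"

definition frac_pow ::
    "'h::complex_hilbert set \<Rightarrow> ('h \<Rightarrow> 'h) \<Rightarrow> real \<Rightarrow> 'h \<Rightarrow> 'h" where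
  "frac_pow D A s x = (\<Sum>\<^sub>\<infinity>l\<in>eigenvalues D A. (l powr s) *\<^sub>R eigenproj D A l x)"


section \<open>Strongly continuous semigroups\<close>

text \<open>The state space is a subspace \<open>X\<close> of a complex vector space, with a norm \<open>N\<close> on \<open>X\<close>. Only
  the restriction of \<open>T t\<close> to \<open>X\<close> for \<open>t \<ge> 0\<close> matters.\<close>

definition c0_semigroup ::
    "'e::complex_vector set \<Rightarrow> ('e \<Rightarrow> real) \<Rightarrow> (real \<Rightarrow> 'e \<Rightarrow> 'e) \<Rightarrow> bool" where
  "c0_semigroup X N T \<longleftrightarrow>
     (\<forall>t\<ge>0. clinear_on X (T t) \<and> T t ` X \<subseteq> X \<and> (\<exists>C. \<forall>x\<in>X. N (T t x) \<le> C * N x)) \<and>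
     (\<forall>x\<in>X. T 0 x = x) \<and>
     (\<forall>s\<ge>0. \<forall>t\<ge>0. \<forall>x\<in>X. T (s + t) x = T s (T t x)) \<and>
     (\<forall>x\<in>X. ((\<lambda>t. N (T t x - x)) \<longlongrightarrow> 0) (at_right 0))"

definition generator_graph ::
    "'e::complex_vector set \<Rightarrow> ('e \<Rightarrow> real) \<Rightarrow> (real \<Rightarrow> 'e \<Rightarrow> 'e) \<Rightarrow> ('e \<times> 'e) set" where
  "generator_graph X N T =
     {(x, y). x \<in> X \<and> y \<in> X \<and>
        ((\<lambda>t. N ((1 / t) *\<^sub>R (T t x - x) - y)) \<longlongrightarrow> 0) (at_right 0)}"

text \<open>\<open>T t\<close> is \<open>e\<^sup>t\<^sup>G\<close> on \<open>X\<close> for \<open>t \<ge> 0\<close>, where the operator \<open>G\<close> has domain \<open>DG\<close>.\<close>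

definition semigroup_generated_by ::
    "'e::complex_vector set \<Rightarrow> ('e \<Rightarrow> real) \<Rightarrow> 'e set \<Rightarrow> ('e \<Rightarrow> 'e) \<Rightarrow> (real \<Rightarrow> 'e \<Rightarrow> 'e) \<Rightarrow> bool"
  where
  "semigroup_generated_by X N DG G T \<longleftrightarrow>
     c0_semigroup X N T \<and> generator_graph X N T = (\<lambda>x. (x, G x)) ` DG"


section \<open>The coupled system\<close>

type_synonym 'h state = "'h \<times> 'h \<times> 'h \<times> 'h"

definition energy_space :: "'h::complex_hilbert set \<Rightarrow> ('h \<Rightarrow> 'h) \<Rightarrow> 'h state set" where
  "energy_space D A = frac_dom D A (1/2) \<times> UNIV \<times> frac_dom D A (1/2) \<times> UNIV"

definition energy_norm ::
    "'h::complex_hilbert set \<Rightarrow> ('h \<Rightarrow> 'h) \<Rightarrow> real \<Rightarrow> 'h state \<Rightarrow> real" where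
  "energy_norm D A a = (\<lambda>(u, v, y, z).
     sqrt (a * (norm (frac_pow D A (1/2) u))\<^sup>2 + (norm (frac_pow D A (1/2) y))\<^sup>2
           + (norm v)\<^sup>2 + (norm z)\<^sup>2))"

definition system_dom :: "'h::complex_hilbert set \<Rightarrow> ('h \<Rightarrow> 'h) \<Rightarrow> 'h state set" where
  "system_dom D A = {(u, v, y, z). (u, v, y, z) \<in> energy_space D A \<and>
     v \<in> frac_dom D A (1/2) \<and> z \<in> frac_dom D A (1/2) \<and> u \<in> D \<and> y \<in> D}"

definition system_op ::
    "'h::complex_hilbert set \<Rightarrow> ('h \<Rightarrow> 'h) \<Rightarrow> real \<Rightarrow> real \<Rightarrow> real \<Rightarrow> 'h state \<Rightarrow> 'h state" where
  "system_op D A a \<gamma> \<alpha> = (\<lambda>(u, v, y, z).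
     (v, - (a *\<^sub>R A u) - frac_pow D A \<gamma> v - \<alpha> *\<^sub>R z, z, - A y + \<alpha> *\<^sub>R v))"

end

theory Submission
  imports Defs
begin

text \<open>The decay comes from a strict quadratic Lyapunov functional. Along a classical solution the energy
  \<open>\<parallel>A\<^sup>1\<^sup>/\<^sup>2 u\<parallel>\<^sup>2 + \<parallel>u\<^sub>t\<parallel>\<^sup>2 + \<parallel>A\<^sup>1\<^sup>/\<^sup>2 y\<parallel>\<^sup>2 + \<parallel>y\<^sub>t\<parallel>\<^sup>2\<close> only satisfies \<open>E' = - 2 \<parallel>u\<^sub>t\<parallel>\<^sup>2\<close>, so the damping is seen in
  \<open>u\<^sub>t\<close> alone. Because both equations have the same propagation speed, the cross term
  \<open>F\<^sub>1 = \<langle>u\<^sub>t, y\<^sub>t\<rangle> + \<langle>A\<^sup>1\<^sup>/\<^sup>2 u, A\<^sup>1\<^sup>/\<^sup>2 y\<rangle>\<close> transfers it to \<open>y\<^sub>t\<close>: the unbounded terms cancel and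
  \<open>F\<^sub>1' = - \<langle>u\<^sub>t, y\<^sub>t\<rangle> - \<alpha> \<parallel>y\<^sub>t\<parallel>\<^sup>2 + \<alpha> \<parallel>u\<^sub>t\<parallel>\<^sup>2\<close>. The usual multiplier
  \<open>F\<^sub>2 = \<langle>u, u\<^sub>t\<rangle> + \<langle>y, y\<^sub>t\<rangle>\<close> then produces \<open>- \<parallel>A\<^sup>1\<^sup>/\<^sup>2 u\<parallel>\<^sup>2 - \<parallel>A\<^sup>1\<^sup>/\<^sup>2 y\<parallel>\<^sup>2\<close> at the price of
  \<open>\<parallel>u\<^sub>t\<parallel>\<^sup>2 + \<parallel>y\<^sub>t\<parallel>\<^sup>2\<close>, which the other two terms control, and of cross terms that Young's inequality
  absorbs. Hence \<open>E + 2 sgn(\<alpha>) e\<^sub>1 F\<^sub>1 + 2 e\<^sub>2 F\<^sub>2\<close> with small \<open>e\<^sub>2 \<lless> e\<^sub>1 \<lless> 1\<close> is equivalent to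
  the energy and decays exponentially (\<open>lyapunov_functional\<close>).

  To work with a complete normed type, the energy space is identified with \<open>H\<^sup>4\<close> by the isometry
  \<open>(u, v, y, z) \<mapsto> (A\<^sup>1\<^sup>/\<^sup>2 u, v, A\<^sup>1\<^sup>/\<^sup>2 y, z)\<close>, whose inverse uses the bounded operator \<open>A\<^sup>-\<^sup>1\<^sup>/\<^sup>2\<close>. That the
  series defining \<open>A\<^sup>s\<close> behave as they should (in particular \<open>A\<^sup>0 = 1\<close>) is the spectral theorem for \<open>A\<close>:
  \<open>A\<close> is onto, \<open>A\<^sup>-\<^sup>1\<close> is compact, symmetric and positive, so its eigenvectors are total
  (\<open>eigenvectors_total\<close>).

  Finally the formal differentiation has to be justified for an abstract \<open>C\<^sub>0\<close>-semigroup, which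
  is given through right limits at \<open>0\<close> only (\<open>lyapunov_exponential_decay\<close>). The uniform boundedness principle makes it locally
  bounded, orbits starting in the domain of the generator are then differentiable, and the domain is dense,
  so that the estimate extends to all initial data.\<close>

section \<open>Strongly continuous semigroups and Lyapunov functionals\<close>

text \<open>By Baire's theorem one of the closed sets on which all \<open>T n\<close> are bounded by \<open>k\<close> contains a ball;
  rescaling the ball to an arbitrary vector gives the norm bound.\<close>
lemma uniform_boundedness:
  fixes T :: "'i \<Rightarrow> 'a::banach \<Rightarrow> 'b::real_normed_vector"
  assumes lin: "\<And>n. bounded_linear (T n)"
    and bdd: "\<And>x. \<exists>k::nat. \<forall>n. norm (T n x) \<le> real k"
  shows "\<exists>C. \<forall>n x. norm (T n x) \<le> C * norm x"
proof -
  define F where "F k = {x. \<forall>n. norm (T n x) \<le> real k}" for k :: nat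
  have closed_F: "closed (F k)" for k
  proof -
    have "closed {x. norm (T n x) \<le> real k}" for n
      by (intro closed_Collect_le continuous_intros linear_continuous_on[OF lin])
    moreover have "F k = (\<Inter>n. {x. norm (T n x) \<le> real k})"
      by (auto simp: F_def)
    ultimately show ?thesis by (simp add: closed_INT)
  qed
  have "\<exists>k. interior (F k) \<noteq> {}"
  proof (rule ccontr)
    assume "\<not> ?thesis"
    then have "euclidean interior_of \<Union>(range F) = {}"
      by (intro Baire_category_alt)
         (auto simp: closed_F completely_metrizable_space_euclidean)
    moreover have "\<Union>(range F) = UNIV"
      using bdd by (auto simp: F_def)
    ultimately show False by simp
  qed
  then obtain k x0 r where r: "r > 0" and ball: "ball x0 r \<subseteq> F k"
    by (metis all_not_in_conv mem_interior)
  have bound: "norm (T n x) \<le> (4 * real k / r) * norm x" for n x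
  proof (cases "x = 0")
    case True
    then show ?thesis by (simp add: linear_simps(3)[OF lin])
  next
    case False
    define s where "s = r / (2 * norm x)"
    have s: "s > 0" using False r by (simp add: s_def)
    have "norm (s *\<^sub>R x) = r / 2" using False r by (simp add: s_def)
    then have "x0 + s *\<^sub>R x \<in> ball x0 r" "x0 \<in> ball x0 r"
      using r by (auto simp: dist_norm)
    then have "norm (T n (x0 + s *\<^sub>R x)) \<le> real k" "norm (T n x0) \<le> real k"
      using subsetD[OF ball] by (simp_all add: F_def)
    moreover have "T n (s *\<^sub>R x) = T n (x0 + s *\<^sub>R x) - T n x0"
      by (simp add: linear_simps[OF lin])
    ultimately have "norm (T n (s *\<^sub>R x)) \<le> 2 * real k"
      using norm_triangle_ineq4[of "T n (x0 + s *\<^sub>R x)" "T n x0"] by simp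
    then have "s * norm (T n x) \<le> 2 * real k"
      using s by (simp add: linear_simps[OF lin])
    then show ?thesis using s r False by (simp add: s_def field_simps)
  qed
  then show ?thesis by blast
qed

locale strong_semigroup =
  fixes S :: "real \<Rightarrow> 'x::banach \<Rightarrow> 'x"
  assumes linear: "t \<ge> 0 \<Longrightarrow> bounded_linear (S t)"
    and at_zero: "S 0 x = x"
    and add: "s \<ge> 0 \<Longrightarrow> t \<ge> 0 \<Longrightarrow> S (s + t) x = S s (S t x)"
    and right_continuous: "((\<lambda>t. S t x) \<longlongrightarrow> x) (at_right 0)"
begin

lemma continuous_at_zero: "continuous (at 0 within {0..}) (\<lambda>t. S t x)"
  using right_continuous[of x]
  by (simp add: continuous_within at_zero at_within_Ici_at_right)

text \<open>If this failed, there would be times \<open>t n \<rightarrow> 0\<close> with operators of unbounded norm, while right continuity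
  at \<open>0\<close> bounds \<open>S (t n) x\<close> for every \<open>x\<close>: a contradiction to uniform boundedness.\<close>
lemma bounded_near_zero:
  "\<exists>d>0. \<exists>C. \<forall>t\<in>{0..d}. \<forall>x. norm (S t x) \<le> C * norm x"
proof (rule ccontr)
  assume neg: "\<not> ?thesis"
  have "\<exists>t. t \<in> {0..inverse (real (Suc n))} \<and> (\<exists>x. norm (S t x) > real n * norm x)" for n
  proof -
    have "inverse (real (Suc n)) > 0" by simp
    then show ?thesis using neg by (metis not_le)
  qed
  then obtain t where t: "\<And>n. t n \<in> {0..inverse (real (Suc n))}"
      and big: "\<And>n. \<exists>x. norm (S (t n) x) > real n * norm x"
    by metis
  have "t \<longlonglongrightarrow> 0"
    using t by (intro tendsto_sandwich[OF _ _ tendsto_const LIMSEQ_inverse_real_of_nat]) auto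
  then have lim: "(\<lambda>n. S (t n) x) \<longlonglongrightarrow> x" for x
    using continuous_at_zero[of x] t
    by (auto simp: continuous_within_sequentially o_def at_zero)
  have "\<exists>k::nat. \<forall>n. norm (S (t n) x) \<le> real k" for x
  proof -
    obtain K where "\<And>n. norm (S (t n) x) \<le> K"
      using convergent_imp_Bseq[OF convergentI[OF lim[of x]]] by (auto simp: Bseq_def)
    then show ?thesis using real_arch_simple[of K] by (meson order_trans)
  qed
  then obtain C where C: "\<And>n x. norm (S (t n) x) \<le> C * norm x"
    using uniform_boundedness[of "\<lambda>n. S (t n)"] linear t by (metis atLeastAtMost_iff)
  obtain n where n: "C \<le> real n" using real_arch_simple by blast
  obtain x where "norm (S (t n) x) > real n * norm x" using big by blast
  moreover have "C * norm x \<le> real n * norm x" using n by (intro mult_right_mono) auto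
  ultimately show False using C[of n x] by linarith
qed

lemma locally_bounded: "\<exists>C>0. \<forall>t\<in>{0..\<tau>}. \<forall>x. norm (S t x) \<le> C * norm x"
proof -
  obtain d C0 where d: "d > 0" and C0: "\<And>t x. t \<in> {0..d} \<Longrightarrow> norm (S t x) \<le> C0 * norm x"
    using bounded_near_zero by blast
  define C where "C = max 1 C0"
  have C1: "C \<ge> 1" by (simp add: C_def)
  have C: "norm (S t x) \<le> C * norm x" if "t \<in> {0..d}" for t x
    using C0[OF that, of x] mult_right_mono[of C0 C "norm x"] by (auto simp: C_def)
  have step: "\<forall>t\<in>{0..real n * d}. \<forall>x. norm (S t x) \<le> C ^ n * norm x" for n
  proof (induction n)
    case 0
    then show ?case by (simp add: at_zero)
  next
    case (Suc n)
    show ?case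
    proof (intro ballI allI)
      fix t x assume t: "t \<in> {0..real (Suc n) * d}"
      show "norm (S t x) \<le> C ^ Suc n * norm x"
      proof (cases "t \<le> d")
        case True
        have "C \<le> C ^ Suc n" using C1 by (simp add: self_le_power)
        then show ?thesis
          using C[of t x] t True mult_right_mono[of C "C ^ Suc n" "norm x"] by auto
      next
        case False
        have "norm (S (d + (t - d)) x) = norm (S d (S (t - d) x))"
          using d False by (subst add) auto
        also have "\<dots> \<le> C * norm (S (t - d) x)" using C d by auto
        also have "\<dots> \<le> C * (C ^ n * norm x)"
          using C1 t False Suc.IH by (intro mult_left_mono) (auto simp: algebra_simps)
        finally show ?thesis by (simp add: mult.assoc)
      qed
    qed
  qed
  obtain n where "\<tau> / d \<le> real n" using real_arch_simple by blast
  then have "{0..\<tau>} \<subseteq> {0..real n * d}" using d by (auto simp: field_simps)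
  then show ?thesis using step[of n] C1 by (intro exI[of _ "C ^ n"]) auto
qed

text \<open>The pair \<open>(x, y)\<close> belongs to the graph of the generator.\<close>
definition right_derivative_at_zero :: "'x \<Rightarrow> 'x \<Rightarrow> bool" where
  "right_derivative_at_zero x y \<longleftrightarrow> ((\<lambda>h. (1 / h) *\<^sub>R (S h x - x)) \<longlongrightarrow> y) (at_right 0)"

lemma right_derivative_orbit:
  assumes "right_derivative_at_zero x y" "t \<ge> 0"
  shows "right_derivative_at_zero (S t x) (S t y)"
proof -
  interpret St: bounded_linear "S t" using linear assms by blast
  have "((\<lambda>h. S t ((1 / h) *\<^sub>R (S h x - x))) \<longlongrightarrow> S t y) (at_right 0)"
    using assms by (intro St.tendsto) (simp add: right_derivative_at_zero_def)
  moreover have "\<forall>\<^sub>F h in at_right 0. S t ((1 / h) *\<^sub>R (S h x - x)) = (1 / h) *\<^sub>R (S h (S t x) - S t x)"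
    using eventually_at_right_less[of 0]
  proof eventually_elim
    case (elim h)
    have "S t (S h x) = S h (S t x)"
      using add[of t h x] add[of h t x] elim assms by (simp add: add.commute)
    then show ?case by (simp add: St.scaleR St.diff)
  qed
  ultimately show ?thesis
    unfolding right_derivative_at_zero_def by (rule Lim_transform_eventually)
qed

text \<open>The generator only controls right difference quotients at time \<open>0\<close>. The left quotient at \<open>t\<close> is
  \<open>S (t - h)\<close> applied to such a quotient, so the derivative is two-sided because
  \<open>S\<close> is bounded uniformly on \<open>{0..t}\<close>. Both quotients are dominated by the same remainder \<open>r\<close>.\<close>
lemma orbit_has_vector_derivative:
  assumes xy: "right_derivative_at_zero x y" and t: "t > 0"
  shows "((\<lambda>s. S s x) has_vector_derivative S t y) (at t)"
proof -
  obtain C where C: "C > 0" "\<And>s w. s \<in> {0..t} \<Longrightarrow> norm (S s w) \<le> C * norm w"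
    using locally_bounded by blast
  define r where "r h = C * (norm ((1 / h) *\<^sub>R (S h x - x) - y) + norm (S h y - y))" for h
  have "(r \<longlongrightarrow> C * (norm (y - y) + norm (y - y))) (at_right 0)"
    unfolding r_def using xy right_continuous[of y]
    by (intro tendsto_intros) (auto simp: right_derivative_at_zero_def)
  then have r0: "(r \<longlongrightarrow> 0) (at_right 0)" by simp
  have "((\<lambda>s. \<bar>s - t\<bar>) \<longlongrightarrow> \<bar>t - t\<bar>) (at t)" by (intro tendsto_intros)
  then have "filterlim (\<lambda>s. \<bar>s - t\<bar>) (at_right 0) (at t)"
    by (auto simp: filterlim_at eventually_at_filter)
  then have lim: "((\<lambda>s. r \<bar>s - t\<bar>) \<longlongrightarrow> 0) (at t)"
    using r0 filterlim_compose by blast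
  have ev: "\<forall>\<^sub>F s in at t. s > 0 \<and> s \<noteq> t"
    using eventually_at_in_open'[of "{0<..}" t] eventually_neq_at_within[of t t UNIV] t
    by (auto elim: eventually_elim2)
  have bound: "norm ((S s x - S t x) - (s - t) *\<^sub>R S t y) / norm (s - t) \<le> r \<bar>s - t\<bar>"
    if s: "s > 0" "s \<noteq> t" for s
  proof (cases "s > t")
    case True
    define h where "h = s - t"
    have h: "h > 0" using True by (simp add: h_def)
    interpret St: bounded_linear "S t" using linear t by simp
    have eq: "S (t + h) x = S t (S h x)" using h t by (intro add) auto
    have "(1 / h) *\<^sub>R ((S s x - S t x) - (s - t) *\<^sub>R S t y)
        = S t ((1 / h) *\<^sub>R (S h x - x) - y)"
      using h eq by (simp add: h_def St.scaleR St.diff scaleR_right_diff_distrib)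
    also have "norm \<dots> \<le> C * norm ((1 / h) *\<^sub>R (S h x - x) - y)"
      using C t by auto
    also have "\<dots> \<le> r h" using C by (simp add: r_def)
    finally show ?thesis using h True by (simp add: h_def)
  next
    case False
    define h where "h = t - s"
    have h: "h > 0" using False s by (simp add: h_def)
    interpret Ss: bounded_linear "S s" using linear s by simp
    have eq: "S t w = S s (S h w)" for w using add[of s h w] h s by (simp add: h_def)
    have st: "s - t = - h" by (simp add: h_def)
    have "(1 / h) *\<^sub>R ((S s x - S t x) - (s - t) *\<^sub>R S t y)
        = - S s (((1 / h) *\<^sub>R (S h x - x) - y) - (S h y - y))"
      unfolding eq st using h
      by (simp add: Ss.scaleR Ss.diff scaleR_right_diff_distrib scaleR_right_distrib)
    also have "norm \<dots> \<le> C * norm (((1 / h) *\<^sub>R (S h x - x) - y) - (S h y - y))"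
      using C s False by auto
    also have "\<dots> \<le> r h" 
      unfolding r_def using C by (intro mult_left_mono norm_triangle_ineq4) simp
    finally show ?thesis using h False by (simp add: h_def abs_if)
  qed
  have "((\<lambda>s. norm ((S s x - S t x) - (s - t) *\<^sub>R S t y) / norm (s - t)) \<longlongrightarrow> 0) (at t)"
    by (rule tendsto_sandwich[OF _ _ tendsto_const lim])
       (use ev bound in \<open>auto elim!: eventually_mono\<close>)
  then show ?thesis
    by (auto simp: has_vector_derivative_def has_derivative_iff_norm intro: bounded_linear_intros)
qed

lemma continuous_on_orbit:
  assumes "right_derivative_at_zero x y"
  shows "continuous_on {0..} (\<lambda>s. S s x)"
proof (clarsimp simp: continuous_on_eq_continuous_within)
  fix s :: real assume "s \<ge> 0"
  show "continuous (at s within {0..}) (\<lambda>s. S s x)"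
  proof (cases "s = 0")
    case True
    then show ?thesis using continuous_at_zero by simp
  next
    case False
    then have "s > 0" using \<open>s \<ge> 0\<close> by simp
    from orbit_has_vector_derivative[OF assms this] show ?thesis
      using continuous_at_imp_continuous_at_within has_vector_derivative_continuous by blast
  qed
qed

end

text \<open>Here \<open>L x = \<langle>J x, x\<rangle>\<close> is the Lyapunov functional. For \<open>x\<close> in the domain of the generator
  \<open>exp (\<omega> t) L (S t x)\<close> is non-increasing, and \<open>L\<close> is equivalent to the squared norm; density of
  the domain and continuity of \<open>S t\<close> give the bound for all \<open>x\<close>.\<close>
theorem lyapunov_exponential_decay:
  fixes S :: "real \<Rightarrow> 'x::{real_inner,banach} \<Rightarrow> 'x"
  assumes "strong_semigroup S"
    and J: "bounded_linear J" and J_sym: "\<And>x y. inner (J x) y = inner x (J y)"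
    and m: "m > 0" "\<And>x. m * (norm x)\<^sup>2 \<le> inner (J x) x"
    and \<omega>: "\<omega> > 0"
    and diss: "\<And>x y. strong_semigroup.right_derivative_at_zero S x y \<Longrightarrow>
                 2 * inner (J x) y \<le> - (\<omega> * inner (J x) x)"
    and dense: "closure {x. \<exists>y. strong_semigroup.right_derivative_at_zero S x y} = UNIV"
  shows "\<exists>M>0. \<exists>\<epsilon>>0. \<forall>t\<ge>0. \<forall>x. norm (S t x) \<le> M * exp (- \<epsilon> * t) * norm x"
proof -
  interpret strong_semigroup S by fact
  obtain K where K: "K > 0" "\<And>x. norm (J x) \<le> norm x * K"
    using bounded_linear.pos_bounded[OF J] by blast
  define M where "M = sqrt (K / m)"
  have M: "M > 0" using K m by (simp add: M_def)
  have core: "norm (S t x) \<le> M * exp (- (\<omega> / 2) * t) * norm x"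
    if xy: "right_derivative_at_zero x y" and t: "t \<ge> 0" for x y t
  proof -
    define g where "g s = exp (\<omega> * s) * inner (J (S s x)) (S s x)" for s
    have "g t \<le> g 0"
    proof (cases "t = 0")
      case False
      show ?thesis
      proof (rule DERIV_nonpos_imp_decreasing_open[of 0 t g])
        show "0 \<le> t" by fact
        have "continuous_on {0..t} (\<lambda>s. S s x)"
          using continuous_on_orbit[OF xy] by (rule continuous_on_subset) auto
        then show "continuous_on {0..t} g"
          unfolding g_def
          by (intro continuous_intros bounded_linear.continuous_on[OF J])
      next
        fix s assume s: "0 < s" "s < t"
        have d: "((\<lambda>s. S s x) has_vector_derivative S s y) (at s)"
          using orbit_has_vector_derivative[OF xy] s by blast
        note dJ = bounded_linear.has_vector_derivative[OF J d]
        have "((\<lambda>s. inner (J (S s x)) (S s x)) has_vector_derivative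
                inner (J (S s x)) (S s y) + inner (J (S s y)) (S s x)) (at s)"
          by (rule bounded_bilinear.has_vector_derivative[OF bounded_bilinear_inner dJ d])
        then have "((\<lambda>s. inner (J (S s x)) (S s x)) has_real_derivative
                2 * inner (J (S s x)) (S s y)) (at s)"
          by (simp add: has_real_derivative_iff_has_vector_derivative
              J_sym[of "S s y"] inner_commute[of "S s y"])
        then have "(g has_real_derivative
             exp (\<omega> * s) * (\<omega> * inner (J (S s x)) (S s x) + 2 * inner (J (S s x)) (S s y))) (at s)"
          unfolding g_def by (auto intro!: derivative_eq_intros simp: algebra_simps)
        moreover have "\<omega> * inner (J (S s x)) (S s x) + 2 * inner (J (S s x)) (S s y) \<le> 0"
          using diss[OF right_derivative_orbit[OF xy, of s]] s by simp
        ultimately show "\<exists>y. DERIV g s :> y \<and> y \<le> 0"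
          by (meson exp_ge_zero mult_nonneg_nonpos)
      qed
    qed simp
    have "m * (norm (S t x))\<^sup>2 \<le> inner (J (S t x)) (S t x)" by (rule m)
    also have "\<dots> = exp (- (\<omega> * t)) * g t" by (simp add: g_def exp_minus field_simps)
    also have "\<dots> \<le> exp (- (\<omega> * t)) * g 0" using \<open>g t \<le> g 0\<close> by simp
    also have "g 0 \<le> K * (norm x)\<^sup>2"
    proof -
      have "inner (J x) x \<le> norm (J x) * norm x" by (rule norm_cauchy_schwarz)
      also have "\<dots> \<le> norm x * K * norm x" using K by (intro mult_right_mono) auto
      finally show ?thesis by (simp add: g_def at_zero power2_eq_square mult_ac)
    qed
    finally have "(norm (S t x))\<^sup>2 \<le> (K / m) * exp (- (\<omega> * t)) * (norm x)\<^sup>2"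
      using m by (simp add: field_simps)
    also have "\<dots> = (M * exp (- (\<omega> / 2) * t) * norm x)\<^sup>2"
      using K m by (simp add: M_def power_mult_distrib flip: exp_double)
    finally show ?thesis using M by (auto intro: power2_le_imp_le)
  qed
  have "norm (S t x) \<le> M * exp (- (\<omega> / 2) * t) * norm x" if t: "t \<ge> 0" for t x
  proof -
    have "closed {x. norm (S t x) \<le> M * exp (- (\<omega> / 2) * t) * norm x}"
      using linear_continuous_on[OF linear[OF t]]
      by (intro closed_Collect_le continuous_intros) auto
    then have "closure {x. \<exists>y. right_derivative_at_zero x y}
        \<subseteq> {x. norm (S t x) \<le> M * exp (- (\<omega> / 2) * t) * norm x}"
      using core t by (intro closure_minimal) blast+
    then show ?thesis using dense by blast
  qed
  then show ?thesis using M \<omega> by (intro exI[of _ M] conjI exI[of _ "\<omega> / 2"]) auto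
qed

section \<open>Orthogonal resolutions of the identity\<close>

text \<open>By Pythagoras the partial sums of \<open>f\<close> are Cauchy as soon as those of the squared norms are.\<close>
lemma summable_on_orthogonal:
  fixes f :: "'i \<Rightarrow> 'h::{real_inner,banach}"
  assumes orth: "\<And>i j. i \<in> I \<Longrightarrow> j \<in> I \<Longrightarrow> i \<noteq> j \<Longrightarrow> inner (f i) (f j) = 0"
    and sq: "(\<lambda>i. (norm (f i))\<^sup>2) summable_on I"
  shows "f summable_on I"
proof -
  have pyth: "(norm (sum f F))\<^sup>2 = (\<Sum>i\<in>F. (norm (f i))\<^sup>2)" if "finite F" "F \<subseteq> I" for F
    using that
  proof (induction F)
    case (insert i F)
    have "inner (f i) (sum f F) = 0"
      using insert by (auto simp: inner_sum_right intro!: sum.neutral orth)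
    then show ?case using insert by (simp add: power2_norm_eq_inner inner_add inner_commute)
  qed simp
  obtain L where L: "((\<lambda>F. \<Sum>i\<in>F. (norm (f i))\<^sup>2) \<longlongrightarrow> L) (finite_subsets_at_top I)"
    using sq unfolding summable_on_def has_sum_def by blast
  have "\<exists>P. eventually P (finite_subsets_at_top I) \<and>
          (\<forall>F F'. P F \<and> P F' \<longrightarrow> dist (sum f F) (sum f F') < e)" if e: "e > 0" for e
  proof -
    define d where "d = (e/2)\<^sup>2 / 2"
    have d: "d > 0" using e by (simp add: d_def)
    have "\<forall>\<^sub>F F in finite_subsets_at_top I. dist (\<Sum>i\<in>F. (norm (f i))\<^sup>2) L < d"
      using L d by (simp add: tendsto_iff)
    then have "\<exists>F0. finite F0 \<and> F0 \<subseteq> I \<and> (\<forall>F. finite F \<and> F0 \<subseteq> F \<and> F \<subseteq> I \<longrightarrow>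
        dist (\<Sum>i\<in>F. (norm (f i))\<^sup>2) L < d)"
      by (simp only: eventually_finite_subsets_at_top)
    then obtain F0 where F0: "finite F0" "F0 \<subseteq> I"
      and near: "\<And>F. finite F \<Longrightarrow> F0 \<subseteq> F \<Longrightarrow> F \<subseteq> I \<Longrightarrow> dist (\<Sum>i\<in>F. (norm (f i))\<^sup>2) L < d"
      by metis
    have half: "dist (sum f F) (sum f F0) < e/2" if F: "finite F" "F0 \<subseteq> F" "F \<subseteq> I" for F
    proof -
      have "(dist (sum f F) (sum f F0))\<^sup>2 = (norm (sum f (F - F0)))\<^sup>2"
        using F by (simp add: dist_norm sum_diff)
      also have "\<dots> = (\<Sum>i\<in>F - F0. (norm (f i))\<^sup>2)"
        using F by (intro pyth) auto
      also have "\<dots> = (\<Sum>i\<in>F. (norm (f i))\<^sup>2) - (\<Sum>i\<in>F0. (norm (f i))\<^sup>2)"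
        using F by (intro sum_diff) auto
      also have "\<dots> < 2 * d"
        using near[OF F] near[OF F0(1) subset_refl F0(2)] by (auto simp: dist_real_def)
      also have "\<dots> = (e/2)\<^sup>2" by (simp add: d_def)
      finally show ?thesis by (rule power2_less_imp_less) (use e in simp)
    qed
    show ?thesis
    proof (intro exI[of _ "\<lambda>F. finite F \<and> F0 \<subseteq> F \<and> F \<subseteq> I"] conjI allI impI)
      show "eventually (\<lambda>F. finite F \<and> F0 \<subseteq> F \<and> F \<subseteq> I) (finite_subsets_at_top I)"
        unfolding eventually_finite_subsets_at_top using F0 by blast
      fix F F' assume "(finite F \<and> F0 \<subseteq> F \<and> F \<subseteq> I) \<and> finite F' \<and> F0 \<subseteq> F' \<and> F' \<subseteq> I"
      then have "dist (sum f F) (sum f F0) < e/2" "dist (sum f F') (sum f F0) < e/2"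
        by (intro half; blast)+
      then show "dist (sum f F) (sum f F') < e"
        by (rule dist_triangle_half_l)
    qed
  qed
  then have "cauchy_filter (filtermap (sum f) (finite_subsets_at_top I))"
    by (simp add: cauchy_filter_metric_filtermap)
  moreover have "complete (UNIV::'h set)"
    by (rule complete_UNIV)
  ultimately obtain l where "(sum f \<longlongrightarrow> l) (finite_subsets_at_top I)"
    using complete_uniform[where S=UNIV] by (force simp: filterlim_def)
  then show ?thesis unfolding summable_on_def has_sum_def by blast
qed

text \<open>Mutually orthogonal projections without a common kernel vector form a discrete resolution of the identity.
  The multiplier \<open>x \<mapsto> \<Sum>l. c l P\<^sub>l x\<close> is then determined by its action on the components, which is how
  identities between functions of an operator are verified below.\<close>
locale projection_family =
  fixes \<Lambda> :: "'i set" and P :: "'i \<Rightarrow> 'h::{real_inner,banach} \<Rightarrow> 'h"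
  assumes linear: "l \<in> \<Lambda> \<Longrightarrow> linear (P l)"
    and sym: "l \<in> \<Lambda> \<Longrightarrow> inner (P l x) y = inner x (P l y)"
    and idem: "l \<in> \<Lambda> \<Longrightarrow> P l (P l x) = P l x"
    and orth: "l \<in> \<Lambda> \<Longrightarrow> k \<in> \<Lambda> \<Longrightarrow> l \<noteq> k \<Longrightarrow> P l (P k x) = 0"
    and total: "(\<And>l. l \<in> \<Lambda> \<Longrightarrow> P l x = 0) \<Longrightarrow> x = 0"
begin

lemma inner_proj: "l \<in> \<Lambda> \<Longrightarrow> inner (P l x) (P l y) = inner x (P l y)"
  using sym[of l x "P l y"] idem by simp

lemma inner_proj_orth: "l \<in> \<Lambda> \<Longrightarrow> k \<in> \<Lambda> \<Longrightarrow> l \<noteq> k \<Longrightarrow> inner (P l x) (P k y) = 0"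
  using sym[of l x "P k y"] orth by simp

lemma norm_proj: "l \<in> \<Lambda> \<Longrightarrow> norm (P l x) \<le> norm x"
proof (cases "P l x = 0")
  case False
  assume l: "l \<in> \<Lambda>"
  have "(norm (P l x))\<^sup>2 = inner x (P l x)" using inner_proj[OF l] by (simp add: power2_norm_eq_inner)
  also have "\<dots> \<le> norm x * norm (P l x)" by (rule norm_cauchy_schwarz)
  finally show ?thesis using False by (simp add: power2_eq_square)
qed simp

lemma bounded_linear_proj: "l \<in> \<Lambda> \<Longrightarrow> bounded_linear (P l)"
  using linear norm_proj
  by (intro bounded_linear_intro[where K = 1]) (auto simp: linear_add linear_scale)

lemma eqI:
  assumes "\<And>l. l \<in> \<Lambda> \<Longrightarrow> P l x = P l y"
  shows "x = y"
  using total[of "x - y"] assms by (auto simp: linear_diff[OF linear])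

lemma bessel:
  assumes "finite F" "F \<subseteq> \<Lambda>"
  shows "(\<Sum>l\<in>F. (norm (P l x))\<^sup>2) \<le> (norm x)\<^sup>2"
proof -
  define s where "s = (\<Sum>l\<in>F. P l x)"
  have xs: "inner x s = (\<Sum>l\<in>F. (norm (P l x))\<^sup>2)"
    using assms by (auto simp: s_def inner_sum_right power2_norm_eq_inner inner_proj intro!: sum.cong)
  have "inner (P l x) s = inner x (P l x)" if "l \<in> F" for l
  proof -
    have "inner (P l x) s = (\<Sum>k\<in>F. if k = l then inner x (P l x) else 0)"
      unfolding s_def inner_sum_right using assms that
      by (intro sum.cong refl) (auto simp: inner_proj inner_proj_orth subset_iff)
    then show ?thesis using assms that by simp
  qed
  then have "(\<Sum>l\<in>F. inner (P l x) s) = (\<Sum>l\<in>F. inner x (P l x))" by simp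
  moreover have "inner s s = (\<Sum>l\<in>F. inner (P l x) s)"
    by (subst (1) s_def) (rule inner_sum_left)
  moreover have "inner x s = (\<Sum>l\<in>F. inner x (P l x))"
    by (simp add: s_def inner_sum_right)
  ultimately have "inner s s = inner x s" by simp
  moreover have "inner (x - s) (x - s) \<ge> 0" by simp
  ultimately show ?thesis
    using xs by (simp add: inner_diff inner_commute power2_norm_eq_inner)
qed

lemma summable_norm_proj: "(\<lambda>l. (norm (P l x))\<^sup>2) summable_on \<Lambda>"
  by (rule nonneg_bdd_above_summable_on, simp, rule bdd_aboveI2[where M = "(norm x)\<^sup>2"])
    (auto intro: bessel)

lemma summable_multiplier:
  assumes "(\<lambda>l. (c l)\<^sup>2 * (norm (P l x))\<^sup>2) summable_on \<Lambda>"
  shows "(\<lambda>l. c l *\<^sub>R P l x) summable_on \<Lambda>"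
  by (rule summable_on_orthogonal) (use assms in \<open>auto simp: inner_proj_orth power_mult_distrib\<close>)

lemma proj_multiplier:
  assumes "(\<lambda>l. (c l)\<^sup>2 * (norm (P l x))\<^sup>2) summable_on \<Lambda>" and k: "k \<in> \<Lambda>"
  shows "P k (\<Sum>\<^sub>\<infinity>l\<in>\<Lambda>. c l *\<^sub>R P l x) = c k *\<^sub>R P k x"
proof -
  have "((\<lambda>l. P k (c l *\<^sub>R P l x)) has_sum P k (\<Sum>\<^sub>\<infinity>l\<in>\<Lambda>. c l *\<^sub>R P l x)) \<Lambda>"
    by (rule has_sum_bounded_linear[OF bounded_linear_proj[OF k]
          has_sum_infsum[OF summable_multiplier[OF assms(1)]]])
  moreover have "((\<lambda>l. P k (c l *\<^sub>R P l x)) has_sum c k *\<^sub>R P k x) \<Lambda>"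
    using k by (intro has_sum_finite_neutralI[of "{k}"])
      (auto simp: linear_scale[OF linear] idem orth)
  ultimately show ?thesis by (rule has_sum_unique)
qed

lemma has_sum_proj: "((\<lambda>l. P l x) has_sum x) \<Lambda>"
proof -
  have sq: "(\<lambda>l. 1\<^sup>2 * (norm (P l x))\<^sup>2) summable_on \<Lambda>"
    using summable_norm_proj by simp
  have "(\<lambda>l. P l x) summable_on \<Lambda>"
    using summable_multiplier[OF sq] by simp
  moreover have "infsum (\<lambda>l. P l x) \<Lambda> = x"
    by (rule eqI) (simp add: proj_multiplier[OF sq, simplified])
  ultimately show ?thesis by (simp add: has_sum_iff)
qed

lemma parseval_inner: "((\<lambda>l. inner (P l x) (P l y)) has_sum inner x y) \<Lambda>"
proof -
  have "((\<lambda>l. inner x (P l y)) has_sum inner x y) \<Lambda>"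
    by (rule has_sum_bounded_linear[OF bounded_linear_inner_right has_sum_proj])
  moreover have "((\<lambda>l. inner x (P l y)) has_sum inner x y) \<Lambda> \<longleftrightarrow>
      ((\<lambda>l. inner (P l x) (P l y)) has_sum inner x y) \<Lambda>"
    by (rule has_sum_cong) (simp add: inner_proj)
  ultimately show ?thesis by simp
qed

lemma parseval: "((\<lambda>l. (norm (P l x))\<^sup>2) has_sum (norm x)\<^sup>2) \<Lambda>"
  using parseval_inner[of x x] by (simp add: power2_norm_eq_inner)

end

section \<open>Compact symmetric operators on Hilbert spaces\<close>

instance complex_hilbert \<subseteq> banach ..

lemma cinner_scaleC_right: "cinner x (c *\<^sub>C y) = cnj c * cinner x y"
  by (metis cinner_commute cinner_scaleC_left complex_cnj_mult)

lemma cinner_self: "cinner x x = complex_of_real ((norm x)\<^sup>2)"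
proof -
  have "Im (cinner x x) = 0"
    by (metis Im_complex_of_real Reals_cnj_iff cinner_commute complex_is_Real_iff)
  then show ?thesis by (simp add: complex_eq_iff Re_cinner power2_norm_eq_inner)
qed

lemma norm_scaleC: "norm (c *\<^sub>C x) = cmod c * norm (x::'a::complex_hilbert)"
proof -
  have "cinner (c *\<^sub>C x) (c *\<^sub>C x) = (c * cnj c) * cinner x x"
    by (simp add: cinner_scaleC_left cinner_scaleC_right)
  then have "complex_of_real ((norm (c *\<^sub>C x))\<^sup>2) = complex_of_real ((cmod c * norm x)\<^sup>2)"
    by (simp only: cinner_self complex_norm_square[symmetric] of_real_mult[symmetric]
        power_mult_distrib)
  then have "(norm (c *\<^sub>C x))\<^sup>2 = (cmod c * norm x)\<^sup>2"
    by (simp only: of_real_eq_iff)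
  then show ?thesis by (rule power2_eq_imp_eq) auto
qed

lemma Im_cinner: "Im (cinner x y) = inner x (\<i> *\<^sub>C y)"
  by (simp add: cinner_scaleC_right flip: Re_cinner)

text \<open>On a set stable under multiplication by \<open>\<i>\<close>, real orthogonality already forces complex orthogonality. This
  lets the spectral theory be carried out with the real inner product alone.\<close>
lemma cinner_eq_iff_inner:
  assumes "\<And>v. v \<in> V \<Longrightarrow> \<i> *\<^sub>C v \<in> V"
  shows "(\<forall>v\<in>V. cinner x v = 0) \<longleftrightarrow> (\<forall>v\<in>V. inner x v = 0)"
  using assms by (auto simp: complex_eq_iff Im_cinner Re_cinner)

text \<open>A minimising sequence for the distance to \<open>V\<close> is Cauchy by the parallelogram law, and its limit is
  the foot of the perpendicular.\<close>
lemma orthogonal_projection_exists: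
  fixes V :: "'h::{real_inner,banach} set"
  assumes V: "subspace V" "closed V"
  shows "\<exists>p\<in>V. \<forall>v\<in>V. inner (f - p) v = 0"
proof -
  define N where "N v = (norm (f - v))\<^sup>2" for v
  define d where "d = Inf (N ` V)"
  have d_le: "d \<le> N v" if "v \<in> V" for v
    unfolding d_def using that by (intro cInf_lower bdd_belowI2[where m = 0]) (auto simp: N_def)
  have "\<exists>v\<in>V. N v < d + inverse (real (Suc n))" for n
  proof -
    have "N ` V \<noteq> {}" using subspace_0[OF V(1)] by blast
    then show ?thesis
      using cInf_lessD[of "N ` V" "d + inverse (real (Suc n))"] by (auto simp: d_def)
  qed
  then obtain v where v: "\<And>n. v n \<in> V" and Nv: "\<And>n. N (v n) < d + inverse (real (Suc n))"
    by metis
  have close: "(norm (v n - v m))\<^sup>2 \<le> 2 * inverse (real (Suc n)) + 2 * inverse (real (Suc m))" for n m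
  proof -
    define u where "u = (1/2) *\<^sub>R (v n + v m)"
    have "u \<in> V" unfolding u_def using V v by (intro subspace_scale subspace_add) auto
    have "(norm (v n - v m))\<^sup>2 = 2 * N (v n) + 2 * N (v m) - 4 * N u"
      unfolding N_def u_def power2_norm_eq_inner
      by (simp add: inner_diff inner_add inner_commute algebra_simps)
    then show ?thesis using d_le[OF \<open>u \<in> V\<close>] Nv[of n] Nv[of m] by linarith
  qed
  have "Cauchy v"
  proof (rule metric_CauchyI)
    fix e :: real assume e: "e > 0"
    obtain K where K: "inverse (real (Suc K)) < e\<^sup>2 / 4"
      using reals_Archimedean[of "e\<^sup>2 / 4"] e by auto
    have "dist (v n) (v m) < e" if "n \<ge> K" "m \<ge> K" for n m
    proof -
      have "inverse (real (Suc n)) \<le> inverse (real (Suc K))"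
           "inverse (real (Suc m)) \<le> inverse (real (Suc K))"
        using that by (simp_all add: field_simps)
      then have "(norm (v n - v m))\<^sup>2 < e\<^sup>2" using close[of n m] K by linarith
      then show ?thesis unfolding dist_norm by (rule power2_less_imp_less) (use e in simp)
    qed
    then show "\<exists>M. \<forall>m\<ge>M. \<forall>n\<ge>M. dist (v m) (v n) < e" by blast
  qed
  then obtain p where p: "v \<longlonglongrightarrow> p" using Cauchy_convergent_iff convergent_def by blast
  have "p \<in> V" using closed_sequentially[OF V(2) v p] .
  have "N p \<le> d"
  proof (rule tendsto_le[OF sequentially_bot])
    show "(\<lambda>n. N (v n)) \<longlonglongrightarrow> N p" unfolding N_def by (intro tendsto_intros p)
    have "(\<lambda>n. d + inverse (real (Suc n))) \<longlonglongrightarrow> d + 0"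
      by (intro tendsto_intros LIMSEQ_inverse_real_of_nat)
    then show "(\<lambda>n. d + inverse (real (Suc n))) \<longlonglongrightarrow> d" by simp
    show "\<forall>\<^sub>F n in sequentially. N (v n) \<le> d + inverse (real (Suc n))"
      using Nv by (simp add: less_imp_le)
  qed
  have "inner (f - p) w = 0" if w: "w \<in> V" for w
  proof (cases "w = 0")
    case False
    \<comment> \<open>the minimiser of the distance along the line through \<open>p\<close> with direction \<open>w\<close>\<close>
    define t where "t = inner (f - p) w / inner w w"
    have "p + t *\<^sub>R w \<in> V" using V w \<open>p \<in> V\<close> by (intro subspace_add subspace_scale)
    then have "N p \<le> N (p + t *\<^sub>R w)" using d_le \<open>N p \<le> d\<close> order_trans by blast
    also have "N (p + t *\<^sub>R w) = N p - 2 * t * inner (f - p) w + t * t * inner w w"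
      unfolding N_def power2_norm_eq_inner
      by (simp add: inner_diff inner_add inner_commute algebra_simps)
    also have "\<dots> = N p - (inner (f - p) w)\<^sup>2 / inner w w"
      using False by (simp add: t_def power2_eq_square)
    finally have "(inner (f - p) w)\<^sup>2 / inner w w \<le> 0" by simp
    moreover have "inner w w > 0" using False by simp
    ultimately show ?thesis by (simp add: divide_le_0_iff not_le[symmetric])
  qed simp
  then show ?thesis using \<open>p \<in> V\<close> by blast
qed

text \<open>Let \<open>M\<close> be the norm of \<open>K\<close> on \<open>W\<close> and \<open>X n\<close> unit vectors with \<open>\<parallel>K (X n)\<parallel> \<rightarrow> M\<close>. Symmetry gives
  \<open>\<parallel>K\<^sup>2 (X n) - M\<^sup>2 (X n)\<parallel>\<^sup>2 \<le> M\<^sup>2 (M\<^sup>2 - \<parallel>K (X n)\<parallel>\<^sup>2) \<rightarrow> 0\<close>, so compactness of \<open>K\<close> makes a subsequence of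
  \<open>X n\<close> itself converge, to a vector \<open>x\<close> with \<open>K\<^sup>2 x = M\<^sup>2 x\<close>. Then \<open>K x + M x\<close> is an eigenvector;
  positivity of \<open>K\<close> keeps it from vanishing.\<close>
lemma compact_symmetric_eigenvector:
  fixes K :: "'h::real_inner \<Rightarrow> 'h"
  assumes K: "bounded_linear K" and sym: "\<And>x y. inner (K x) y = inner x (K y)"
    and pos: "\<And>x. x \<noteq> 0 \<Longrightarrow> inner (K x) x > 0"
    and compact: "\<And>X::nat \<Rightarrow> 'h. bounded (range X) \<Longrightarrow>
          \<exists>l r. strict_mono r \<and> (\<lambda>n. K (X (r n))) \<longlonglongrightarrow> l"
    and W: "subspace W" "closed W" "\<And>x. x \<in> W \<Longrightarrow> K x \<in> W" and x0: "x0 \<in> W" "x0 \<noteq> 0"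
  shows "\<exists>w\<in>W. w \<noteq> 0 \<and> (\<exists>M>0. K w = M *\<^sub>R w)"
proof -
  interpret K: bounded_linear K by fact
  define U where "U = {x \<in> W. norm x = 1}"
  define M where "M = (SUP x\<in>U. norm (K x))"
  have normalised: "inverse (norm x) *\<^sub>R x \<in> U" if "x \<in> W" "x \<noteq> 0" for x
    using that W by (auto simp: U_def intro: subspace_scale)
  obtain B where B: "\<And>x. norm (K x) \<le> norm x * B" using K.bounded by blast
  have bdd: "bdd_above ((\<lambda>x. norm (K x)) ` U)"
  proof (rule bdd_aboveI2)
    show "norm (K x) \<le> B" if "x \<in> U" for x using B[of x] that by (simp add: U_def)
  qed
  have le_U: "norm (K x) \<le> M" if "x \<in> U" for x
    unfolding M_def using that bdd by (rule cSUP_upper)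
  have le: "norm (K x) \<le> M * norm x" if "x \<in> W" for x
  proof (cases "x = 0")
    case False
    then have "inverse (norm x) * norm (K x) \<le> M"
      using le_U[OF normalised[OF that False]] by (simp add: K.scaleR)
    then show ?thesis using False by (simp add: field_simps)
  qed (simp add: K.zero)
  have ne: "U \<noteq> {}" using normalised[OF x0] by blast
  have "M > 0"
  proof -
    have "K x0 \<noteq> 0" using pos[OF x0(2)] by auto
    then have "0 < norm (K x0)" by simp
    also have "\<dots> \<le> M * norm x0" by (rule le[OF x0(1)])
    finally show ?thesis by (simp add: zero_less_mult_iff)
  qed
  have "\<exists>x\<in>U. M - inverse (real (Suc n)) < norm (K x)" for n
    using less_cSUP_iff[OF ne bdd, of "M - inverse (real (Suc n))"] by (simp add: M_def)
  then obtain X where X: "\<And>n. X n \<in> U" and near: "\<And>n. M - inverse (real (Suc n)) < norm (K (X n))"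
    by metis
  have "bounded (range X)" using X by (auto simp: bounded_iff U_def)
  from compact[OF this] obtain l r where r: "strict_mono r" and l: "(\<lambda>n. K (X (r n))) \<longlonglongrightarrow> l"
    by blast
  define Y where "Y n = X (r n)" for n
  have Y: "Y n \<in> W" "norm (Y n) = 1" for n using X[of "r n"] by (auto simp: Y_def U_def)
  have KY: "(\<lambda>n. K (Y n)) \<longlonglongrightarrow> l" using l by (simp add: Y_def)
  have "(\<lambda>n. norm (K (X n))) \<longlonglongrightarrow> M"
  proof (rule tendsto_sandwich[OF _ _ _ tendsto_const])
    show "\<forall>\<^sub>F n in sequentially. norm (K (X n)) \<le> M" using le_U X by simp
    show "\<forall>\<^sub>F n in sequentially. M - inverse (real (Suc n)) \<le> norm (K (X n))"
      using near by (simp add: less_imp_le)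
    have "(\<lambda>n. M - inverse (real (Suc n))) \<longlonglongrightarrow> M - 0"
      by (intro tendsto_intros LIMSEQ_inverse_real_of_nat)
    then show "(\<lambda>n. M - inverse (real (Suc n))) \<longlonglongrightarrow> M" by simp
  qed
  from LIMSEQ_subseq_LIMSEQ[OF this r] have nKY: "(\<lambda>n. norm (K (Y n))) \<longlonglongrightarrow> M"
    by (simp add: Y_def o_def)
  have defect: "(norm (K (K (Y n)) - M\<^sup>2 *\<^sub>R Y n))\<^sup>2 \<le> M\<^sup>2 * (M\<^sup>2 - (norm (K (Y n)))\<^sup>2)" for n
  proof -
    have "(norm (K (K (Y n)) - M\<^sup>2 *\<^sub>R Y n))\<^sup>2
        = (norm (K (K (Y n))))\<^sup>2 - 2 * M\<^sup>2 * inner (K (K (Y n))) (Y n) + M\<^sup>2 * M\<^sup>2 * (norm (Y n))\<^sup>2"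
      unfolding power2_norm_eq_inner by (simp add: inner_diff inner_commute algebra_simps)
    also have "inner (K (K (Y n))) (Y n) = (norm (K (Y n)))\<^sup>2"
      using sym[of "K (Y n)" "Y n"] by (simp add: power2_norm_eq_inner)
    also have "(norm (K (K (Y n))))\<^sup>2 \<le> (M * norm (K (Y n)))\<^sup>2"
      using le[OF W(3)[OF Y(1)]] by (intro power_mono) auto
    finally show ?thesis using Y by (simp add: power_mult_distrib algebra_simps)
  qed
  have "(\<lambda>n. (norm (K (K (Y n)) - M\<^sup>2 *\<^sub>R Y n))\<^sup>2) \<longlonglongrightarrow> 0"
  proof (rule tendsto_sandwich[OF _ _ tendsto_const])
    show "\<forall>\<^sub>F n in sequentially. (norm (K (K (Y n)) - M\<^sup>2 *\<^sub>R Y n))\<^sup>2 \<le> M\<^sup>2 * (M\<^sup>2 - (norm (K (Y n)))\<^sup>2)"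
      using defect by simp
    have "(\<lambda>n. M\<^sup>2 * (M\<^sup>2 - (norm (K (Y n)))\<^sup>2)) \<longlonglongrightarrow> M\<^sup>2 * (M\<^sup>2 - M\<^sup>2)"
      by (intro tendsto_intros nKY)
    then show "(\<lambda>n. M\<^sup>2 * (M\<^sup>2 - (norm (K (Y n)))\<^sup>2)) \<longlonglongrightarrow> 0" by simp
  qed simp
  then have "(\<lambda>n. norm (K (K (Y n)) - M\<^sup>2 *\<^sub>R Y n)) \<longlonglongrightarrow> 0"
    using tendsto_real_sqrt by fastforce
  then have "(\<lambda>n. K (K (Y n)) - M\<^sup>2 *\<^sub>R Y n) \<longlonglongrightarrow> 0" by (rule tendsto_norm_zero_cancel)
  then have "(\<lambda>n. (1 / M\<^sup>2) *\<^sub>R (K (K (Y n)) - (K (K (Y n)) - M\<^sup>2 *\<^sub>R Y n))) \<longlonglongrightarrow> (1 / M\<^sup>2) *\<^sub>R (K l - 0)"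
    by (intro tendsto_intros K.tendsto KY)
  then have Ylim: "Y \<longlonglongrightarrow> (1 / M\<^sup>2) *\<^sub>R K l" using \<open>M > 0\<close> by simp
  define x where "x = (1 / M\<^sup>2) *\<^sub>R K l"
  have x: "x \<in> W" "norm x = 1"
  proof -
    show "x \<in> W" using closed_sequentially[OF W(2) Y(1)] Ylim by (simp add: x_def)
    have "(\<lambda>n. norm (Y n)) \<longlonglongrightarrow> norm x" unfolding x_def by (intro tendsto_intros Ylim)
    then show "norm x = 1" using Y(2) LIMSEQ_unique[of "\<lambda>_. 1::real"] by simp
  qed
  have "K x = l" using K.tendsto[OF Ylim] KY LIMSEQ_unique unfolding x_def by blast
  then have KK: "K (K x) = M\<^sup>2 *\<^sub>R x" using \<open>M > 0\<close> by (simp add: x_def)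
  define w where "w = K x + M *\<^sub>R x"
  have "w \<in> W" unfolding w_def using W x by (intro subspace_add subspace_scale) auto
  moreover have "K w = M *\<^sub>R w"
    by (simp add: w_def K.add K.scaleR KK scaleR_right_distrib power2_eq_square)
  moreover have "w \<noteq> 0"
  proof -
    have "x \<noteq> 0" using x by auto
    then have "inner w x > 0" unfolding w_def inner_add_left
      using pos[of x] \<open>M > 0\<close> by (intro add_pos_pos) auto
    then show ?thesis by auto
  qed
  ultimately show ?thesis using \<open>M > 0\<close> by blast
qed

section \<open>Spectral decomposition of coercive self-adjoint operators\<close>

locale coercive_operator =
  fixes D :: "'h::complex_hilbert set" and A :: "'h \<Rightarrow> 'h" and c :: real
  assumes self_adjoint: "self_adjoint D A"
    and compact_resolvent: "compact_resolvent D A"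
    and simple_spectrum: "simple_spectrum D A"
    and c_pos: "c > 0"
    and lower_bound: "x \<in> D \<Longrightarrow> c * (norm x)\<^sup>2 \<le> inner (A x) x"
begin

lemma csubspace_dom: "csubspace D"
  and add: "x \<in> D \<Longrightarrow> y \<in> D \<Longrightarrow> A (x + y) = A x + A y"
  and scaleC: "x \<in> D \<Longrightarrow> A (k *\<^sub>C x) = k *\<^sub>C A x"
  and dense_dom: "closure D = UNIV"
  using self_adjoint by (auto simp: self_adjoint_def clinear_on_def)

lemma scaleR: "x \<in> D \<Longrightarrow> A (r *\<^sub>R x) = r *\<^sub>R A x"
  using scaleC[of x "complex_of_real r"] by (simp add: scaleC_of_real)

lemma dom_zero: "0 \<in> D" and dom_add: "x \<in> D \<Longrightarrow> y \<in> D \<Longrightarrow> x + y \<in> D"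
  and dom_scaleC: "x \<in> D \<Longrightarrow> k *\<^sub>C x \<in> D"
  using csubspace_dom
  by (auto intro: complex_vector.subspace_0 complex_vector.subspace_add complex_vector.subspace_scale)

lemma dom_scaleR: "x \<in> D \<Longrightarrow> r *\<^sub>R x \<in> D"
  using dom_scaleC[of x "complex_of_real r"] by (simp add: scaleC_of_real)

lemma subspace_dom: "subspace D"
  by (auto simp: subspace_def dom_zero dom_add dom_scaleR)

lemma diff: "x \<in> D \<Longrightarrow> y \<in> D \<Longrightarrow> A (x - y) = A x - A y"
  using add[of x "(-1) *\<^sub>R y"] scaleR[of y "-1"] dom_scaleR[of y "-1"] by simp

lemma cinner_symmetric:
  assumes "x \<in> D" "y \<in> D"
  shows "cinner (A x) y = cinner x (A y)"
proof -
  have "(y, A y) \<in> adjoint_graph D A"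
    using self_adjoint assms by (auto simp: self_adjoint_def)
  then show ?thesis using assms by (simp add: adjoint_graph_def)
qed

lemma symmetric: "x \<in> D \<Longrightarrow> y \<in> D \<Longrightarrow> inner (A x) y = inner x (A y)"
  using cinner_symmetric[of x y] by (simp flip: Re_cinner)

text \<open>Membership in the domain of the adjoint, which is \<open>D\<close> itself, can be tested with the real inner
  product because \<open>D\<close> is stable under multiplication by \<open>\<i>\<close>.\<close>
lemma maximal:
  assumes "\<And>x. x \<in> D \<Longrightarrow> inner (A x) y = inner x z"
  shows "y \<in> D" "A y = z"
proof -
  have "cinner (A x) y = cinner x z" if x: "x \<in> D" for x
  proof (rule complex_eqI)
    show "Re (cinner (A x) y) = Re (cinner x z)"
      using assms[OF x] by (simp add: Re_cinner)
    have "Re (\<i> * cinner (A x) y) = Re (\<i> * cinner x z)"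
      using assms[OF dom_scaleC[OF x, of \<i>]]
      by (simp only: scaleC[OF x] Re_cinner[symmetric] cinner_scaleC_left)
    then show "Im (cinner (A x) y) = Im (cinner x z)" by simp
  qed
  then have "(y, z) \<in> adjoint_graph D A" by (simp add: adjoint_graph_def)
  then show "y \<in> D" "A y = z" using self_adjoint by (auto simp: self_adjoint_def)
qed

lemma norm_lower_bound:
  assumes "x \<in> D" shows "c * norm x \<le> norm (A x)"
proof (cases "x = 0")
  case False
  have "c * norm x * norm x \<le> norm (A x) * norm x"
    using lower_bound[OF assms] norm_cauchy_schwarz[of "A x" x] by (simp add: power2_eq_square)
  then show ?thesis using False by simp
qed simp

text \<open>By coercivity, convergence of \<open>A (X n)\<close> forces that of \<open>X n\<close>, and the graph of a self-adjoint operator is closed.\<close>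
lemma closed_range: "closed (A ` D)"
proof (unfold closed_sequential_limits, intro allI impI, elim conjE)
  fix Y y assume "\<forall>n. Y n \<in> A ` D" and Y: "Y \<longlonglongrightarrow> y"
  then have "\<forall>n. \<exists>x. x \<in> D \<and> Y n = A x" by blast
  from choice[OF this] obtain X where X: "\<And>n. X n \<in> D" and YX: "\<And>n. Y n = A (X n)"
    by auto
  have "Cauchy X"
  proof (rule metric_CauchyI)
    fix e :: real assume "e > 0"
    then have "c * e > 0" using c_pos by simp
    then obtain N where N: "\<And>m n. m \<ge> N \<Longrightarrow> n \<ge> N \<Longrightarrow> dist (Y m) (Y n) < c * e"
      using LIMSEQ_imp_Cauchy[OF Y] metric_CauchyD by blast
    have "dist (X m) (X n) < e" if "m \<ge> N" "n \<ge> N" for m n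
    proof -
      have "X m - X n \<in> D" using subspace_diff[OF subspace_dom X X] .
      then have "c * dist (X m) (X n) \<le> dist (Y m) (Y n)"
        using norm_lower_bound[of "X m - X n"] by (simp add: dist_norm YX diff X)
      also have "\<dots> < c * e" by (rule N[OF that])
      finally show ?thesis using c_pos by simp
    qed
    then show "\<exists>M. \<forall>m\<ge>M. \<forall>n\<ge>M. dist (X m) (X n) < e" by blast
  qed
  then obtain x where x: "X \<longlonglongrightarrow> x" using Cauchy_convergent_iff convergent_def by blast
  have "inner (A w) x = inner w y" if w: "w \<in> D" for w
  proof -
    have "(\<lambda>n. inner (A w) (X n)) \<longlonglongrightarrow> inner (A w) x" by (intro tendsto_intros x)
    moreover have "(\<lambda>n. inner (A w) (X n)) \<longlonglongrightarrow> inner w y"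
      using tendsto_inner[OF tendsto_const Y, of w] by (simp add: symmetric[OF w X] YX)
    ultimately show ?thesis by (rule LIMSEQ_unique)
  qed
  then show "y \<in> A ` D" using maximal[of x y] by blast
qed

text \<open>The component of \<open>f\<close> orthogonal to the closed range lies in the kernel of the adjoint, that is of \<open>A\<close>, which is trivial.\<close>
lemma surjective: "\<exists>x\<in>D. A x = f"
proof -
  have sub: "subspace (A ` D)"
  proof (rule subspaceI)
    show "0 \<in> A ` D" using scaleR[OF dom_zero, of 0] dom_zero by force
    show "x + y \<in> A ` D" if "x \<in> A ` D" "y \<in> A ` D" for x y
      using that add dom_add by (metis (no_types, lifting) image_iff)
    show "r *\<^sub>R x \<in> A ` D" if "x \<in> A ` D" for r x
      using that scaleR dom_scaleR by (metis (no_types, lifting) image_iff)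
  qed
  obtain p where p: "p \<in> A ` D" "\<And>v. v \<in> A ` D \<Longrightarrow> inner (f - p) v = 0"
    using orthogonal_projection_exists[OF sub closed_range] by blast
  have "inner (A x) (f - p) = inner x 0" if "x \<in> D" for x
    using p(2)[of "A x"] that by (simp add: inner_commute)
  from maximal[OF this] have "f - p \<in> D" "A (f - p) = 0" by auto
  then have "f - p = 0"
    using norm_lower_bound[of "f - p"] c_pos by (simp add: mult_le_0_iff)
  then show ?thesis using p(1) by auto
qed

definition inverse_op :: "'h \<Rightarrow> 'h" where "inverse_op = inv_into D A"

lemma inverse_op_dom: "inverse_op y \<in> D" and op_inverse_op: "A (inverse_op y) = y"
proof -
  have "y \<in> A ` D" using surjective[of y] by auto
  then show "inverse_op y \<in> D" "A (inverse_op y) = y"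
    unfolding inverse_op_def by (rule inv_into_into, rule f_inv_into_f)
qed

lemma injective:
  assumes "x \<in> D" "y \<in> D" "A x = A y" shows "x = y"
proof -
  have "c * norm (x - y) \<le> 0"
    using norm_lower_bound[OF subspace_diff[OF subspace_dom assms(1,2)]] assms by (simp add: diff)
  then show ?thesis using c_pos by (simp add: mult_le_0_iff)
qed

lemma inverse_op_eqI: "x \<in> D \<Longrightarrow> A x = y \<Longrightarrow> inverse_op y = x"
  using injective inverse_op_dom op_inverse_op by metis

lemma bounded_linear_inverse_op: "bounded_linear inverse_op"
proof (rule bounded_linear_intro[where K = "1 / c"])
  show "inverse_op (x + y) = inverse_op x + inverse_op y" for x y
    by (rule inverse_op_eqI) (simp_all add: dom_add inverse_op_dom add op_inverse_op)
  show "inverse_op (r *\<^sub>R x) = r *\<^sub>R inverse_op x" for r x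
    by (rule inverse_op_eqI) (simp_all add: dom_scaleR inverse_op_dom scaleR op_inverse_op)
  show "norm (inverse_op x) \<le> norm x * (1 / c)" for x
    using norm_lower_bound[OF inverse_op_dom[of x]] c_pos by (simp add: op_inverse_op field_simps)
qed

lemma inverse_op_symmetric: "inner (inverse_op x) y = inner x (inverse_op y)"
  using symmetric[OF inverse_op_dom inverse_op_dom, of x y] by (simp add: op_inverse_op)

lemma inverse_op_pos:
  assumes "x \<noteq> 0" shows "inner (inverse_op x) x > 0"
proof -
  have "inverse_op x \<noteq> 0"
    using assms op_inverse_op[of x] scaleR[OF dom_zero, of 0] by auto
  then have "0 < c * (norm (inverse_op x))\<^sup>2" using c_pos by simp
  also have "\<dots> \<le> inner (inverse_op x) x"
    using lower_bound[OF inverse_op_dom[of x]] by (simp add: op_inverse_op inner_commute)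
  finally show ?thesis .
qed

text \<open>Only the resolvent at some \<open>\<mu>\<close>, possibly non-real, is known to be compact. It carries over to
  \<open>A\<^sup>-\<^sup>1\<close> by the resolvent identity \<open>A\<^sup>-\<^sup>1 = R(\<mu>) (1 - \<mu> A\<^sup>-\<^sup>1)\<close>.\<close>
lemma inverse_op_compact:
  fixes X :: "nat \<Rightarrow> 'h"
  assumes "bounded (range X)"
  shows "\<exists>l r. strict_mono r \<and> (\<lambda>n. inverse_op (X (r n))) \<longlonglongrightarrow> l"
proof -
  obtain \<mu> where \<mu>: "\<mu> \<in> resolvent_set D A" and cpt: "compact_operator (resolvent D A \<mu>)"
    using compact_resolvent by (auto simp: compact_resolvent_def)
  have inj: "inj_on (\<lambda>x. A x - \<mu> *\<^sub>C x) D"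
    using \<mu> by (simp add: resolvent_set_def bij_betw_def)
  define Y where "Y n = X n - \<mu> *\<^sub>C inverse_op (X n)" for n
  have res: "resolvent D A \<mu> (Y n) = inverse_op (X n)" for n
    using inv_into_f_f[OF inj inverse_op_dom[of "X n"]]
    by (simp add: resolvent_def Y_def op_inverse_op)
  obtain B where B: "\<And>n. norm (X n) \<le> B"
    using assms by (auto simp: bounded_iff)
  have "norm (Y n) \<le> B + cmod \<mu> * (B / c)" for n
  proof -
    have "c * norm (inverse_op (X n)) \<le> B"
      using norm_lower_bound[OF inverse_op_dom[of "X n"]] B[of n] by (simp add: op_inverse_op)
    then have "norm (inverse_op (X n)) \<le> B / c" using c_pos by (simp add: field_simps)
    then have "norm (\<mu> *\<^sub>C inverse_op (X n)) \<le> cmod \<mu> * (B / c)"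
      unfolding norm_scaleC by (rule mult_left_mono) simp
    then show ?thesis
      unfolding Y_def using norm_triangle_ineq4[of "X n" "\<mu> *\<^sub>C inverse_op (X n)"] B[of n] by linarith
  qed
  then have "bounded (range Y)" by (auto simp: bounded_iff)
  then have "compact (closure (resolvent D A \<mu> ` range Y))"
    using cpt by (simp add: compact_operator_def)
  then have "seq_compact (closure (resolvent D A \<mu> ` range Y))"
    by (rule compact_imp_seq_compact)
  moreover have "\<forall>n. inverse_op (X n) \<in> closure (resolvent D A \<mu> ` range Y)"
  proof
    fix n
    have "inverse_op (X n) \<in> resolvent D A \<mu> ` range Y"
      by (rule image_eqI[OF _ rangeI[of Y n]]) (simp add: res)
    then show "inverse_op (X n) \<in> closure (resolvent D A \<mu> ` range Y)"
      by (rule subsetD[OF closure_subset])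
  qed
  ultimately obtain l r where "strict_mono r" "((\<lambda>n. inverse_op (X n)) \<circ> r) \<longlonglongrightarrow> l"
    by (rule seq_compactE)
  then show ?thesis by (auto simp: o_def)
qed

abbreviation "\<Lambda> \<equiv> eigenvalues D A"
abbreviation "E l \<equiv> eigenspace D A (complex_of_real l)"
abbreviation "P \<equiv> eigenproj D A"

lemma mem_E: "x \<in> E l \<longleftrightarrow> x \<in> D \<and> A x = l *\<^sub>R x"
  by (simp add: eigenspace_def scaleC_of_real)

lemma csubspace_E: "csubspace (E l)"
  by (auto intro!: complex_vector.subspaceI simp: eigenspace_def dom_zero dom_add dom_scaleC add
      scaleC scaleC_add_right scaleC_scaleC mult.commute)
     (use scaleC[OF dom_zero, of 0] in simp)

lemma subspace_E: "subspace (E l)"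
  using csubspace_E[of l] unfolding complex_vector.subspace_def subspace_def
  by (metis scaleC_of_real)

lemma scaleC_E: "x \<in> E l \<Longrightarrow> k *\<^sub>C x \<in> E l"
  using csubspace_E by (rule complex_vector.subspace_scale)

lemma eigenvalue_ge: "l \<in> \<Lambda> \<Longrightarrow> c \<le> l"
proof -
  assume "l \<in> \<Lambda>"
  then obtain x where x: "x \<in> E l" "x \<noteq> 0" by (auto simp: eigenvalues_def)
  then have "c * (norm x)\<^sup>2 \<le> l * (norm x)\<^sup>2"
    using lower_bound[of x] by (auto simp: mem_E power2_norm_eq_inner)
  then show ?thesis using x by simp
qed

lemma eigenvalue_pos: "l \<in> \<Lambda> \<Longrightarrow> l > 0"
  using eigenvalue_ge c_pos by force

text \<open>An eigenvalue lies in the spectrum, so simplicity applies and its eigenspace is a complex line.\<close>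
lemma eigenspace_line:
  assumes "l \<in> \<Lambda>" shows "\<exists>e. norm e = 1 \<and> E l = range (\<lambda>k. k *\<^sub>C e)"
proof -
  obtain x where x: "x \<in> E l" "x \<noteq> 0" using assms by (auto simp: eigenvalues_def)
  have "complex_of_real l \<notin> resolvent_set D A"
  proof
    assume "complex_of_real l \<in> resolvent_set D A"
    then have inj: "inj_on (\<lambda>x. A x - complex_of_real l *\<^sub>C x) D"
      by (simp add: resolvent_set_def bij_betw_def)
    have "A 0 = 0" using scaleR[OF dom_zero, of 0] by simp
    then have "A x - complex_of_real l *\<^sub>C x = A 0 - complex_of_real l *\<^sub>C 0"
      using x by (simp add: mem_E scaleC_of_real)
    from inj_onD[OF inj this] have "x = 0" using x dom_zero by (simp add: mem_E)
    then show False using x by simp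
  qed
  then have "cdim (E l) = 1"
    using simple_spectrum by (simp add: simple_spectrum_def op_spectrum_def)
  moreover obtain B where B: "B \<subseteq> E l" "E l \<subseteq> cspan B" "card B = cdim (E l)"
    by (rule complex_vector.basis_exists[of "E l"])
  ultimately obtain b where b: "B = {b}" by (metis card_1_singletonE)
  have E: "E l = range (\<lambda>k. k *\<^sub>C b)"
    using B complex_vector.span_minimal[OF B(1) csubspace_E] b
    by (auto simp: complex_vector.span_singleton)
  have "b \<noteq> 0" using x E by (auto simp: complex_vector.scale_zero_right)
  define e where "e = complex_of_real (inverse (norm b)) *\<^sub>C b"
  have "norm e = 1" using \<open>b \<noteq> 0\<close> by (simp add: e_def norm_scaleC norm_inverse)
  moreover have "E l = range (\<lambda>k. k *\<^sub>C e)"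
  proof -
    have "k *\<^sub>C b \<in> range (\<lambda>k. k *\<^sub>C e)" for k
      by (rule image_eqI[of _ _ "k * complex_of_real (norm b)"])
        (use \<open>b \<noteq> 0\<close> in \<open>simp_all add: e_def scaleC_scaleC\<close>)
    moreover have "k *\<^sub>C e \<in> range (\<lambda>k. k *\<^sub>C b)" for k
      by (rule image_eqI[of _ _ "k * complex_of_real (inverse (norm b))"])
        (simp_all add: e_def scaleC_scaleC)
    ultimately show ?thesis unfolding E by (intro equalityI image_subsetI)
  qed
  ultimately show ?thesis by blast
qed

lemma orthogonal_E_iff: "(\<forall>e\<in>E l. cinner x e = 0) \<longleftrightarrow> (\<forall>e\<in>E l. inner x e = 0)"
  by (rule cinner_eq_iff_inner) (rule scaleC_E)

lemma eigenproj_unique: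
  assumes "p \<in> E l" "q \<in> E l" "\<And>e. e \<in> E l \<Longrightarrow> inner (x - p) e = 0" "\<And>e. e \<in> E l \<Longrightarrow> inner (x - q) e = 0"
  shows "p = q"
proof -
  have "p - q \<in> E l" using subspace_E assms by (blast intro: subspace_diff)
  then have "inner (x - q) (p - q) - inner (x - p) (p - q) = 0" using assms by simp
  then have "inner (p - q) (p - q) = 0" by (simp add: inner_diff)
  then show ?thesis by simp
qed

text \<open>On a line spanned by a unit vector \<open>u\<close> the projection is \<open>\<langle>x, u\<rangle> u\<close>, so the definite description that
  defines the projection is meaningful.\<close>
lemma eigenproj:
  assumes "l \<in> \<Lambda>"
  shows "P l x \<in> E l" "e \<in> E l \<Longrightarrow> inner (x - P l x) e = 0"
proof -
  obtain u where u: "norm u = 1" "E l = range (\<lambda>k. k *\<^sub>C u)" using eigenspace_line[OF assms] by blast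
  define p where "p = cinner x u *\<^sub>C u"
  have "cinner (x - p) (k *\<^sub>C u) = 0" for k
  proof -
    have "cinner (x - p) u + cinner p u = cinner x u" by (simp flip: cinner_add_left)
    moreover have "cinner p u = cinner x u" by (simp add: p_def cinner_scaleC_left cinner_self u)
    ultimately show ?thesis by (simp add: cinner_scaleC_right)
  qed
  then have p: "p \<in> E l \<and> (\<forall>e\<in>E l. cinner (x - p) e = 0)"
    unfolding u(2) by (auto simp: p_def)
  have "\<exists>!p. p \<in> E l \<and> (\<forall>e\<in>E l. cinner (x - p) e = 0)"
  proof (rule ex1I[of _ p])
    show "q = p" if "q \<in> E l \<and> (\<forall>e\<in>E l. cinner (x - q) e = 0)" for q
      using eigenproj_unique[of q l p x] that p by (simp add: orthogonal_E_iff)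
  qed (rule p)
  from theI'[OF this] have "P l x \<in> E l \<and> (\<forall>e\<in>E l. inner (x - P l x) e = 0)"
    by (simp add: eigenproj_def orthogonal_E_iff)
  then show "P l x \<in> E l" "e \<in> E l \<Longrightarrow> inner (x - P l x) e = 0" by auto
qed

lemma eigenproj_eqI:
  assumes "l \<in> \<Lambda>" "p \<in> E l" "\<And>e. e \<in> E l \<Longrightarrow> inner (x - p) e = 0"
  shows "P l x = p"
  using eigenproj_unique[of "P l x" l p x] eigenproj[OF assms(1)] assms by blast

lemma eigenspaces_orthogonal:
  assumes "l \<noteq> k" "x \<in> E l" "y \<in> E k" shows "inner x y = 0"
proof -
  have "l * inner x y = k * inner x y"
    using symmetric[of x y] assms by (simp add: mem_E)
  then show ?thesis using assms by simp
qed

text \<open>The orthogonal complement of all eigenvectors is closed and invariant under the compact operator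
  \<open>A\<^sup>-\<^sup>1\<close>. If it were nonzero it would contain an eigenvector, which would be orthogonal to itself.\<close>
lemma eigenvectors_total:
  assumes "\<And>l e. l \<in> \<Lambda> \<Longrightarrow> e \<in> E l \<Longrightarrow> inner x e = 0"
  shows "x = 0"
proof (rule ccontr)
  assume "x \<noteq> 0"
  define W where "W = {x. \<forall>l\<in>\<Lambda>. \<forall>e\<in>E l. inner x e = 0}"
  have "subspace W" by (auto simp: W_def subspace_def inner_add_left)
  moreover have "closed W"
  proof -
    have "W = (\<Inter>l\<in>\<Lambda>. \<Inter>e\<in>E l. {x. inner x e = 0})" by (auto simp: W_def)
    then show ?thesis by (auto intro!: closed_INT closed_Collect_eq continuous_intros)
  qed
  moreover have "inverse_op y \<in> W" if "y \<in> W" for y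
  proof -
    have "inner (inverse_op y) e = 0" if l: "l \<in> \<Lambda>" and e: "e \<in> E l" for l e
    proof -
      have "l * inner (inverse_op y) e = inner (inverse_op y) (A e)" using e by (simp add: mem_E)
      also have "\<dots> = inner y e"
        using e symmetric[OF inverse_op_dom, of e y] by (simp add: mem_E op_inverse_op)
      also have "\<dots> = 0" using \<open>y \<in> W\<close> l e by (simp add: W_def)
      finally show ?thesis using eigenvalue_pos[OF l] by simp
    qed
    then show ?thesis by (simp add: W_def)
  qed
  moreover have "x \<in> W" using assms by (simp add: W_def)
  ultimately obtain w M where w: "w \<in> W" "w \<noteq> 0" "M > 0" "inverse_op w = M *\<^sub>R w"
    using compact_symmetric_eigenvector[OF bounded_linear_inverse_op inverse_op_symmetric
        inverse_op_pos inverse_op_compact] \<open>x \<noteq> 0\<close> by metis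
  have wD: "w \<in> D"
    using dom_scaleR[OF inverse_op_dom[of w], of "1 / M"] w by simp
  have "w = M *\<^sub>R A w" using op_inverse_op[of w] w scaleR[OF wD, of M] by simp
  from arg_cong[OF this, of "\<lambda>u. (1 / M) *\<^sub>R u"] have "A w = (1 / M) *\<^sub>R w"
    using w(3) by simp
  then have "w \<in> E (1 / M)" using wD unfolding mem_E by simp
  moreover from this have "1 / M \<in> \<Lambda>" using w(2) unfolding eigenvalues_def by blast
  ultimately have "inner w w = 0" using w(1) by (simp add: W_def)
  then show False using w(2) by simp
qed

sublocale projection_family \<Lambda> P
proof (rule projection_family.intro)
  fix l assume l: "l \<in> \<Lambda>"
  note PE = eigenproj(1)[OF l] and Po = eigenproj(2)[OF l]
  show "Real_Vector_Spaces.linear (P l)"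
  proof (rule linearI)
    show "P l (x + y) = P l x + P l y" for x y
    proof (rule eigenproj_eqI[OF l subspace_add[OF subspace_E PE PE]])
      show "inner (x + y - (P l x + P l y)) e = 0" if "e \<in> E l" for e
        using Po[OF that, of x] Po[OF that, of y] by (simp add: inner_diff inner_add)
    qed
    show "P l (r *\<^sub>R x) = r *\<^sub>R P l x" for r x
    proof (rule eigenproj_eqI[OF l subspace_scale[OF subspace_E PE]])
      show "inner (r *\<^sub>R x - r *\<^sub>R P l x) e = 0" if "e \<in> E l" for e
        using Po[OF that, of x] by (simp flip: scaleR_diff_right)
    qed
  qed
  show "inner (P l x) y = inner x (P l y)" for x y
    using Po[OF PE[of y], of x] Po[OF PE[of x], of y] by (simp add: inner_diff inner_commute)
  show "P l (P l x) = P l x" for x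
    by (rule eigenproj_eqI[OF l PE]) simp
  show "P l (P k x) = 0" if "k \<in> \<Lambda>" "l \<noteq> k" for k x
    using eigenspaces_orthogonal[of k l] that eigenproj(1)[OF that(1)]
    by (intro eigenproj_eqI[OF l subspace_0[OF subspace_E]]) auto
next
  fix x assume x: "\<And>l. l \<in> \<Lambda> \<Longrightarrow> P l x = 0"
  show "x = 0"
    using eigenproj(2)[of _ _ x] x by (intro eigenvectors_total) force
qed

lemma eigenproj_op:
  assumes "l \<in> \<Lambda>" "x \<in> D" shows "P l (A x) = l *\<^sub>R P l x"
proof (rule eigenproj_eqI[OF assms(1) subspace_scale[OF subspace_E eigenproj(1)[OF assms(1)]]])
  fix e assume e: "e \<in> E l"
  have "inner (A x) e = l * inner x e" using e assms(2) symmetric[of x e] by (simp add: mem_E)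
  then show "inner (A x - l *\<^sub>R P l x) e = 0"
    using eigenproj(2)[OF assms(1) e, of x] by (simp add: inner_diff flip: right_diff_distrib)
qed

end

section \<open>The Lyapunov functional of the coupled system\<close>

text \<open>The scalar estimate behind the Lyapunov functional: \<open>p, v, q, z\<close> stand for the norms of
  \<open>A\<^sup>1\<^sup>/\<^sup>2 u, u\<^sub>t, A\<^sup>1\<^sup>/\<^sup>2 y, y\<^sub>t\<close>, \<open>k\<close> for \<open>\<bar>\<alpha>\<bar>\<close> and \<open>\<kappa>\<close> for the norm of \<open>A\<^sup>-\<^sup>1\<^sup>/\<^sup>2\<close>. The
  damping \<open>- v\<^sup>2\<close> has to absorb what \<open>e1\<close> costs, and the gain \<open>- e1 k z\<^sup>2\<close> what \<open>e2\<close> costs, whence \<open>e2\<close> is a small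
  multiple of \<open>e1 k\<close>.\<close>
lemma coercivity_constants:
  fixes k \<kappa> :: real
  assumes k: "k > 0" and \<kappa>: "\<kappa> \<ge> 0"
  obtains e1 e2 \<eta> :: real where "e1 > 0" "e2 > 0" "\<eta> > 0" "e1 + e2 * \<kappa> \<le> 1 / 2"
    "\<And>p v q z. - v\<^sup>2 + e1 * (z * v) - e1 * k * z\<^sup>2 + e1 * k * v\<^sup>2
        + e2 * (v\<^sup>2 + z\<^sup>2 - p\<^sup>2 - q\<^sup>2 + \<kappa> * p * v + k * (\<kappa> * p * z) + k * (\<kappa> * q * v))
      \<le> - (\<eta> * (p\<^sup>2 + v\<^sup>2 + q\<^sup>2 + z\<^sup>2))"
proof -
  \<comment> \<open>\<open>b\<close> bounds the coefficients of \<open>v\<^sup>2\<close> and \<open>z\<^sup>2\<close> that the \<open>e2\<close>-term produces; \<open>e1\<close> is small enough for \<open>e1 / (2 k) + 5 e1 k / 4 \<le> 1 / 2\<close>, which leaves half of the damping\<close>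
  define b where "b = 1 + \<kappa>\<^sup>2 + k\<^sup>2 * \<kappa>\<^sup>2"
  define e1 where "e1 = 1 / (1 / k + 4 * k + 4)"
  define e2 where "e2 = e1 * k / (4 * b)"
  define \<eta> where "\<eta> = min (1 / 2) (min (e1 * k / 4) (e2 / 2))"
  have b: "b \<ge> 1" by (simp add: b_def)
  have den: "1 / k + 4 * k + 4 > 0" using k by (intro add_pos_pos) auto
  have e1: "e1 > 0" using den by (simp add: e1_def)
  have e2: "e2 > 0" using e1 k b by (simp add: e2_def)
  have "e1 * (1 / k + 4 * k + 4) = 1" using den by (simp add: e1_def)
  then have e1_eq: "e1 / k + 4 * (e1 * k) + 4 * e1 = 1" by (simp add: algebra_simps)
  have e1k: "e1 * k > 0" "e1 / k > 0" using e1 k by auto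
  have e2b: "e2 * b = e1 * k / 4" using b by (simp add: e2_def)
  have "e2 * \<kappa> \<le> e2 * b"
  proof -
    have "\<kappa> \<le> 1 + \<kappa>\<^sup>2" using sum_squares_bound[of \<kappa> 1] \<kappa> by simp
    also have "\<dots> \<le> b" by (simp add: b_def)
    finally show ?thesis using e2 by simp
  qed
  then have small: "e1 + e2 * \<kappa> \<le> 1 / 2" using e2b e1_eq e1k e1 by linarith
  have \<eta>: "\<eta> > 0" using e1k e2 by (simp add: \<eta>_def)
  have main: "- v\<^sup>2 + e1 * (z * v) - e1 * k * z\<^sup>2 + e1 * k * v\<^sup>2
        + e2 * (v\<^sup>2 + z\<^sup>2 - p\<^sup>2 - q\<^sup>2 + \<kappa> * p * v + k * (\<kappa> * p * z) + k * (\<kappa> * q * v))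
      \<le> - (\<eta> * (p\<^sup>2 + v\<^sup>2 + q\<^sup>2 + z\<^sup>2))" for p v q z
  proof -
    have young: "x * y \<le> x\<^sup>2 / 4 + y\<^sup>2" for x y :: real
      using sum_squares_bound[of "x / 2" y] by (simp add: power2_eq_square)
    have zv: "e1 * (z * v) \<le> e1 * k * z\<^sup>2 / 2 + (e1 / k) * v\<^sup>2 / 2"
    proof -
      have "z * v \<le> k * z\<^sup>2 / 2 + v\<^sup>2 / (2 * k)"
        using sum_squares_bound[of "k * z" v] k by (simp add: field_simps power2_eq_square)
      then have "e1 * (z * v) \<le> e1 * (k * z\<^sup>2 / 2 + v\<^sup>2 / (2 * k))" using e1 by simp
      then show ?thesis by (simp add: algebra_simps)
    qed
    have cross: "v\<^sup>2 + z\<^sup>2 - p\<^sup>2 - q\<^sup>2 + \<kappa> * p * v + k * (\<kappa> * p * z) + k * (\<kappa> * q * v)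
        \<le> b * v\<^sup>2 + b * z\<^sup>2 - p\<^sup>2 / 2 - q\<^sup>2 / 2"
    proof -
      have "p * (\<kappa> * v) \<le> p\<^sup>2 / 4 + \<kappa>\<^sup>2 * v\<^sup>2" "p * (k * \<kappa> * z) \<le> p\<^sup>2 / 4 + k\<^sup>2 * \<kappa>\<^sup>2 * z\<^sup>2"
           "q * (k * \<kappa> * v) \<le> q\<^sup>2 / 4 + k\<^sup>2 * \<kappa>\<^sup>2 * v\<^sup>2"
        using young[of p "\<kappa> * v"] young[of p "k * \<kappa> * z"] young[of q "k * \<kappa> * v"]
        by (simp_all add: power_mult_distrib)
      moreover have "b * v\<^sup>2 = v\<^sup>2 + \<kappa>\<^sup>2 * v\<^sup>2 + k\<^sup>2 * \<kappa>\<^sup>2 * v\<^sup>2"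
          "b * z\<^sup>2 = z\<^sup>2 + \<kappa>\<^sup>2 * z\<^sup>2 + k\<^sup>2 * \<kappa>\<^sup>2 * z\<^sup>2"
        by (simp_all add: b_def algebra_simps)
      moreover have "\<kappa> * p * v = p * (\<kappa> * v)" "k * (\<kappa> * p * z) = p * (k * \<kappa> * z)"
          "k * (\<kappa> * q * v) = q * (k * \<kappa> * v)"
        by simp_all
      moreover have "0 \<le> \<kappa>\<^sup>2 * z\<^sup>2" "0 \<le> q\<^sup>2" by auto
      ultimately show ?thesis by linarith
    qed
    have "e2 * (v\<^sup>2 + z\<^sup>2 - p\<^sup>2 - q\<^sup>2 + \<kappa> * p * v + k * (\<kappa> * p * z) + k * (\<kappa> * q * v))
        \<le> e2 * (b * v\<^sup>2 + b * z\<^sup>2 - p\<^sup>2 / 2 - q\<^sup>2 / 2)"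
      using cross e2 by simp
    also have "\<dots> = (e2 * b) * v\<^sup>2 + (e2 * b) * z\<^sup>2 - e2 / 2 * p\<^sup>2 - e2 / 2 * q\<^sup>2"
      by (simp add: algebra_simps)
    finally have "- v\<^sup>2 + e1 * (z * v) - e1 * k * z\<^sup>2 + e1 * k * v\<^sup>2
        + e2 * (v\<^sup>2 + z\<^sup>2 - p\<^sup>2 - q\<^sup>2 + \<kappa> * p * v + k * (\<kappa> * p * z) + k * (\<kappa> * q * v))
      \<le> - ((1 - (e1 / k) / 2 - e1 * k - e1 * k / 4) * v\<^sup>2 + e1 * k / 4 * z\<^sup>2
          + e2 / 2 * p\<^sup>2 + e2 / 2 * q\<^sup>2)"
      using zv unfolding e2b by (simp add: algebra_simps)
    also have "\<dots> \<le> - (\<eta> * v\<^sup>2 + \<eta> * z\<^sup>2 + \<eta> * p\<^sup>2 + \<eta> * q\<^sup>2)"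
    proof -
      have half: "\<eta> \<le> 1 / 2" by (simp add: \<eta>_def)
      have "\<eta> \<le> 1 - (e1 / k) / 2 - e1 * k - e1 * k / 4"
      proof -
        have "h \<le> 1 - x / 2 - y - y / 4"
          if "x + 4 * y + 4 * r = 1" "x > 0" "y > 0" "r > 0" "h \<le> 1 / 2" for x y r h :: real
          using that by linarith
        from this[OF e1_eq e1k(2,1) e1 half] show ?thesis .
      qed
      moreover have "\<eta> \<le> e1 * k / 4" "\<eta> \<le> e2 / 2" by (auto simp: \<eta>_def)
      ultimately show ?thesis
        unfolding neg_le_iff_le by (intro add_mono mult_right_mono) auto
    qed
    also have "\<dots> = - (\<eta> * (p\<^sup>2 + v\<^sup>2 + q\<^sup>2 + z\<^sup>2))" by (simp add: algebra_simps)
    finally show ?thesis .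
  qed
  show thesis by (rule that[OF e1 e2 \<eta> small main])
qed

text \<open>In the coordinates \<open>(p, v, q, z) = (A\<^sup>1\<^sup>/\<^sup>2 u, u\<^sub>t, A\<^sup>1\<^sup>/\<^sup>2 y, y\<^sub>t)\<close> and with \<open>R = A\<^sup>-\<^sup>1\<^sup>/\<^sup>2\<close>, the form \<open>\<langle>J w, w\<rangle>\<close> is
  \<open>\<parallel>w\<parallel>\<^sup>2 + 2 s (\<langle>p, q\<rangle> + \<langle>v, z\<rangle>) + 2 e2 (\<langle>R p, v\<rangle> + \<langle>R q, z\<rangle>)\<close>, where \<open>s\<close> carries the sign of \<open>\<alpha>\<close> so that
  \<open>- s \<alpha> \<parallel>z\<parallel>\<^sup>2\<close> is negative. The vectors \<open>y1, y3, f, g\<close> stand for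
  \<open>A\<^sup>1\<^sup>/\<^sup>2 v, A\<^sup>1\<^sup>/\<^sup>2 z, A u, A y\<close>, so the second argument of the inner product is the time derivative of \<open>w\<close>.\<close>
lemma lyapunov_functional:
  fixes R :: "'h::real_inner \<Rightarrow> 'h" and \<alpha> :: real
  assumes R: "bounded_linear R" and sym: "\<And>x y. inner (R x) y = inner x (R y)"
    and bound: "\<And>x. norm (R x) \<le> \<kappa> * norm x" and \<kappa>: "\<kappa> \<ge> 0" and \<alpha>: "\<alpha> \<noteq> 0"
  obtains J :: "'h \<times> 'h \<times> 'h \<times> 'h \<Rightarrow> 'h \<times> 'h \<times> 'h \<times> 'h" and m \<omega> :: real
  where "bounded_linear J" "\<And>w w'. inner (J w) w' = inner w (J w')"
    "m > 0" "\<And>w. m * (norm w)\<^sup>2 \<le> inner (J w) w" "\<omega> > 0"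
    "\<And>p v q z f g y1 y3. R y1 = v \<Longrightarrow> R y3 = z \<Longrightarrow> R f = p \<Longrightarrow> R g = q \<Longrightarrow>
       2 * inner (J (p, v, q, z)) (y1, - f - v - \<alpha> *\<^sub>R z, y3, - g + \<alpha> *\<^sub>R v)
       \<le> - (\<omega> * inner (J (p, v, q, z)) (p, v, q, z))"
proof -
  obtain e1 e2 \<eta> where e1: "e1 > 0" and e2: "e2 > 0" and \<eta>: "\<eta> > 0"
    and small: "e1 + e2 * \<kappa> \<le> 1 / 2"
    and main: "\<And>p v q z. - v\<^sup>2 + e1 * (z * v) - e1 * \<bar>\<alpha>\<bar> * z\<^sup>2 + e1 * \<bar>\<alpha>\<bar> * v\<^sup>2
        + e2 * (v\<^sup>2 + z\<^sup>2 - p\<^sup>2 - q\<^sup>2 + \<kappa> * p * v + \<bar>\<alpha>\<bar> * (\<kappa> * p * z) + \<bar>\<alpha>\<bar> * (\<kappa> * q * v))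
      \<le> - (\<eta> * (p\<^sup>2 + v\<^sup>2 + q\<^sup>2 + z\<^sup>2))"
    using coercivity_constants[of "\<bar>\<alpha>\<bar>" \<kappa>] \<alpha> \<kappa> by (metis zero_less_abs_iff)
  define s where "s = sgn \<alpha> * e1"
  have s: "\<bar>s\<bar> = e1" "s * \<alpha> = e1 * \<bar>\<alpha>\<bar>"
    using \<alpha> e1 by (auto simp: s_def sgn_if)
  define J :: "'h \<times> 'h \<times> 'h \<times> 'h \<Rightarrow> 'h \<times> 'h \<times> 'h \<times> 'h" where
    "J w = (fst w + s *\<^sub>R fst (snd (snd w)) + e2 *\<^sub>R R (fst (snd w)),
            fst (snd w) + s *\<^sub>R snd (snd (snd w)) + e2 *\<^sub>R R (fst w),
            fst (snd (snd w)) + s *\<^sub>R fst w + e2 *\<^sub>R R (snd (snd (snd w))),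
            snd (snd (snd w)) + s *\<^sub>R fst (snd w) + e2 *\<^sub>R R (fst (snd (snd w))))" for w
  have J: "J (p, v, q, z) = (p + s *\<^sub>R q + e2 *\<^sub>R R v, v + s *\<^sub>R z + e2 *\<^sub>R R p,
      q + s *\<^sub>R p + e2 *\<^sub>R R z, z + s *\<^sub>R v + e2 *\<^sub>R R q)" for p v q z
    by (simp add: J_def)
  have nrm: "(norm (p, v, q, z))\<^sup>2 = (norm p)\<^sup>2 + (norm v)\<^sup>2 + (norm q)\<^sup>2 + (norm z)\<^sup>2"
    for p v q z :: 'h by (simp add: norm_Pair)
  have cs: "\<bar>inner x y\<bar> \<le> norm x * norm y" for x y :: 'h by (rule Cauchy_Schwarz_ineq2)
  have csR: "\<bar>inner (R x) y\<bar> \<le> \<kappa> * norm x * norm y" for x y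
    using cs[of "R x" y] mult_right_mono[OF bound[of x] norm_ge_zero[of y]] by linarith
  have form: "\<bar>inner (J w) w - (norm w)\<^sup>2\<bar> \<le> (norm w)\<^sup>2 / 2" for w
  proof -
    obtain p v q z where w: "w = (p, v, q, z)" by (metis prod.exhaust)
    have eq: "inner (J w) w - (norm w)\<^sup>2
        = s * (2 * inner p q + 2 * inner v z) + e2 * (2 * inner (R p) v + 2 * inner (R q) z)"
    proof -
      have "inner (R v) p = inner (R p) v" "inner (R z) q = inner (R q) z"
        by (metis sym inner_commute)+
      moreover have "inner q p = inner p q" "inner z v = inner v z"
        by (simp_all add: inner_commute)
      ultimately show ?thesis
        unfolding w J nrm
        by (simp add: inner_add_left power2_norm_eq_inner algebra_simps)
    qed
    have ab: "2 * \<bar>inner x y\<bar> \<le> (norm x)\<^sup>2 + (norm y)\<^sup>2" for x y :: 'h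
      using cs[of x y] sum_squares_bound[of "norm x" "norm y"] by linarith
    have abR: "2 * \<bar>inner (R x) y\<bar> \<le> \<kappa> * ((norm x)\<^sup>2 + (norm y)\<^sup>2)" for x y
      using csR[of x y] mult_left_mono[OF sum_squares_bound[of "norm x" "norm y"] \<kappa>]
      by (simp add: mult_ac)
    have "\<bar>inner (J w) w - (norm w)\<^sup>2\<bar>
        \<le> \<bar>s\<bar> * \<bar>2 * inner p q + 2 * inner v z\<bar> + \<bar>e2\<bar> * \<bar>2 * inner (R p) v + 2 * inner (R q) z\<bar>"
      unfolding eq abs_mult[symmetric] by (rule abs_triangle_ineq)
    also have "\<dots> \<le> e1 * (norm w)\<^sup>2 + e2 * (\<kappa> * (norm w)\<^sup>2)"
    proof -
      have "\<bar>2 * inner p q + 2 * inner v z\<bar> \<le> (norm w)\<^sup>2"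
        using ab[of p q] ab[of v z] unfolding w nrm by linarith
      moreover have "\<bar>2 * inner (R p) v + 2 * inner (R q) z\<bar> \<le> \<kappa> * (norm w)\<^sup>2"
        using abR[of p v] abR[of q z] unfolding w nrm by (simp add: distrib_left)
      ultimately show ?thesis
        using e1 e2 unfolding s by (intro add_mono mult_left_mono) auto
    qed
    also have "\<dots> = (e1 + e2 * \<kappa>) * (norm w)\<^sup>2" by (simp add: algebra_simps)
    also have "\<dots> \<le> 1 / 2 * (norm w)\<^sup>2" using small by (intro mult_right_mono) auto
    finally show ?thesis by simp
  qed
  show thesis
  proof (rule that[of J "1/2" \<eta>])
    show "bounded_linear J"
      unfolding J_def
      by (intro bounded_linear_Pair bounded_linear_add bounded_linear_const_scaleR
          bounded_linear_compose[OF R] bounded_linear_fst_comp bounded_linear_snd_comp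
          bounded_linear_ident)
    show "inner (J w) w' = inner w (J w')" for w w'
      by (cases w, cases w') (auto simp: J_def inner_add_left inner_add_right sym)
    show "1 / 2 * (norm w)\<^sup>2 \<le> inner (J w) w" for w using form[of w] by linarith
    show "2 * inner (J (p, v, q, z)) (y1, - f - v - \<alpha> *\<^sub>R z, y3, - g + \<alpha> *\<^sub>R v)
       \<le> - (\<eta> * inner (J (p, v, q, z)) (p, v, q, z))"
      if v: "R y1 = v" and z: "R y3 = z" and p: "R f = p" and q: "R g = q" for p v q z f g y1 y3
    proof -
      have double: "2 * x \<le> - (\<eta> * (2 * y))" if "x \<le> - (\<eta> * y)" for x y
        using that by simp
      have swap: "inner (R a) b = inner (R b) a" for a b using sym[of a b] by (simp add: inner_commute)
      \<comment> \<open>all terms with \<open>y1, y3, f, g\<close> either cancel in pairs or become bounded after moving \<open>R\<close> across\<close>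
      have "inner (J (p, v, q, z)) (y1, - f - v - \<alpha> *\<^sub>R z, y3, - g + \<alpha> *\<^sub>R v)
          = - (norm v)\<^sup>2 - s * inner z v - (s * \<alpha>) * (norm z)\<^sup>2 + (s * \<alpha>) * (norm v)\<^sup>2
            + e2 * ((norm v)\<^sup>2 + (norm z)\<^sup>2 - (norm p)\<^sup>2 - (norm q)\<^sup>2
                - inner (R p) v - \<alpha> * inner (R p) z + \<alpha> * inner (R q) v)"
      proof -
        have "inner p y1 = inner v f" "inner q y1 = inner v g" "inner p y3 = inner z f"
            "inner q y3 = inner z g"
          unfolding v[symmetric] z[symmetric] p[symmetric] q[symmetric] by (simp_all add: swap)
        moreover have "inner (R v) y1 = inner v v" "inner (R z) y3 = inner z z"
            "inner (R p) f = inner p p" "inner (R q) g = inner q q"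
          by (simp_all add: sym v z p q)
        moreover have "inner v z = inner z v" by (rule inner_commute)
        ultimately show ?thesis
          unfolding J power2_norm_eq_inner
          by (simp add: inner_add_left inner_add_right inner_diff_right distrib_left
              right_diff_distrib)
      qed
      also have "\<dots> \<le> - (norm v)\<^sup>2 + e1 * (norm z * norm v)
            - e1 * \<bar>\<alpha>\<bar> * (norm z)\<^sup>2 + e1 * \<bar>\<alpha>\<bar> * (norm v)\<^sup>2
            + e2 * ((norm v)\<^sup>2 + (norm z)\<^sup>2 - (norm p)\<^sup>2 - (norm q)\<^sup>2
                + \<kappa> * norm p * norm v + \<bar>\<alpha>\<bar> * (\<kappa> * norm p * norm z) + \<bar>\<alpha>\<bar> * (\<kappa> * norm q * norm v))"
      proof -
        have abs_le: "\<bar>\<alpha> * inner (R x) y\<bar> \<le> \<bar>\<alpha>\<bar> * (\<kappa> * norm x * norm y)" for x y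
          unfolding abs_mult by (intro mult_left_mono csR) auto
        have "\<bar>s * inner z v\<bar> \<le> e1 * (norm z * norm v)"
          unfolding abs_mult s using e1 by (intro mult_left_mono cs) auto
        then have zv: "- s * inner z v \<le> e1 * (norm z * norm v)" by (simp add: abs_le_iff)
        have "(norm v)\<^sup>2 + (norm z)\<^sup>2 - (norm p)\<^sup>2 - (norm q)\<^sup>2
                - inner (R p) v - \<alpha> * inner (R p) z + \<alpha> * inner (R q) v
            \<le> (norm v)\<^sup>2 + (norm z)\<^sup>2 - (norm p)\<^sup>2 - (norm q)\<^sup>2
                + \<kappa> * norm p * norm v + \<bar>\<alpha>\<bar> * (\<kappa> * norm p * norm z) + \<bar>\<alpha>\<bar> * (\<kappa> * norm q * norm v)"
          using csR[of p v] abs_le[of p z] abs_le[of q v] by linarith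
        from mult_left_mono[OF this less_imp_le[OF e2]]
        show ?thesis unfolding s(2) by (rule add_mono[rotated]) (use zv in simp)
      qed
      also have "\<dots> \<le> - (\<eta> * (norm (p, v, q, z))\<^sup>2)"
        using main unfolding nrm .
      finally have "2 * inner (J (p, v, q, z)) (y1, - f - v - \<alpha> *\<^sub>R z, y3, - g + \<alpha> *\<^sub>R v)
          \<le> - (\<eta> * (2 * (norm (p, v, q, z))\<^sup>2))" by (rule double)
      also have "\<dots> \<le> - (\<eta> * inner (J (p, v, q, z)) (p, v, q, z))"
      proof -
        have "inner (J (p, v, q, z)) (p, v, q, z) \<le> 2 * (norm (p, v, q, z))\<^sup>2"
          using form[of "(p, v, q, z)"] zero_le_power2[of "norm (p, v, q, z)"] by linarith
        then show ?thesis using \<eta> by simp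
      qed
      finally show ?thesis .
    qed
  qed (use \<eta> in simp_all)
qed

section \<open>Fractional powers and exponential stability\<close>

context coercive_operator
begin

lemma proj_frac_pow:
  assumes "x \<in> frac_dom D A s" "l \<in> \<Lambda>"
  shows "P l (frac_pow D A s x) = (l powr s) *\<^sub>R P l x"
  using proj_multiplier[of "\<lambda>l. l powr s" x l] assms by (simp only: frac_dom_def frac_pow_def mem_Collect_eq)

lemma eigenvalue_powr_le: "s \<le> 0 \<Longrightarrow> l \<in> \<Lambda> \<Longrightarrow> l powr s \<le> c powr s"
  using eigenvalue_ge c_pos by (intro powr_mono2') auto

lemma frac_dom_nonpos:
  assumes "s \<le> 0" shows "frac_dom D A s = UNIV"
proof -
  have "(\<lambda>l. (l powr s)\<^sup>2 * (norm (P l x))\<^sup>2) summable_on \<Lambda>" for x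
  proof (rule summable_on_comparison_test)
    show "(\<lambda>l. (c powr s)\<^sup>2 * (norm (P l x))\<^sup>2) summable_on \<Lambda>"
      by (rule summable_on_cmult_right[OF summable_norm_proj])
    show "(l powr s)\<^sup>2 * (norm (P l x))\<^sup>2 \<le> (c powr s)\<^sup>2 * (norm (P l x))\<^sup>2" if "l \<in> \<Lambda>" for l
      using eigenvalue_powr_le[OF assms that] by (intro mult_right_mono power_mono) auto
  qed simp
  then show ?thesis by (auto simp: frac_dom_def)
qed

lemma proj_frac_pow_nonpos:
  "s \<le> 0 \<Longrightarrow> l \<in> \<Lambda> \<Longrightarrow> P l (frac_pow D A s x) = (l powr s) *\<^sub>R P l x"
  by (simp add: proj_frac_pow frac_dom_nonpos)

lemma frac_pow_zero: "frac_pow D A 0 x = x"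
proof (rule eqI)
  fix l assume "l \<in> \<Lambda>"
  then show "P l (frac_pow D A 0 x) = P l x"
    using eigenvalue_pos[of l] by (simp add: proj_frac_pow_nonpos)
qed

lemma norm_frac_pow_nonpos:
  assumes "s \<le> 0" shows "norm (frac_pow D A s x) \<le> c powr s * norm x"
proof -
  have "(norm (frac_pow D A s x))\<^sup>2 \<le> (c powr s)\<^sup>2 * (norm x)\<^sup>2"
  proof (rule has_sum_mono[OF parseval has_sum_cmult_right[OF parseval]])
    show "(norm (P l (frac_pow D A s x)))\<^sup>2 \<le> (c powr s)\<^sup>2 * (norm (P l x))\<^sup>2" if "l \<in> \<Lambda>" for l
      using eigenvalue_powr_le[OF assms that]
      by (auto simp: proj_frac_pow_nonpos[OF assms that] power_mult_distrib
          intro!: mult_right_mono power_mono)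
  qed
  then have "(norm (frac_pow D A s x))\<^sup>2 \<le> (c powr s * norm x)\<^sup>2"
    by (simp add: power_mult_distrib)
  then show ?thesis by (rule power2_le_imp_le) simp
qed

text \<open>\<open>A\<^sup>1\<^sup>/\<^sup>2\<close> is unbounded, whereas \<open>A\<^sup>-\<^sup>1\<^sup>/\<^sup>2\<close> is bounded, symmetric and maps onto the form
  domain \<open>V\<close>. Statements about \<open>A\<^sup>1\<^sup>/\<^sup>2\<close> are therefore reduced to this inverse.\<close>
definition inv_root :: "'h \<Rightarrow> 'h" where "inv_root = frac_pow D A (- (1/2))"
abbreviation root :: "'h \<Rightarrow> 'h" where "root \<equiv> frac_pow D A (1/2)"
abbreviation V :: "'h set" where "V \<equiv> frac_dom D A (1/2)"

lemma proj_inv_root: "l \<in> \<Lambda> \<Longrightarrow> P l (inv_root x) = (l powr (- (1/2))) *\<^sub>R P l x"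
  by (simp add: inv_root_def proj_frac_pow_nonpos)

lemma powr_half_cancel:
  assumes "l \<in> \<Lambda>"
  shows "l powr (1/2) * l powr (- (1/2)) = 1" "l powr (- (1/2)) * l powr (1/2) = 1"
    "l powr (- (1/2)) * (l powr (- (1/2)) * l) = 1"
proof -
  have l: "l > 0" by (rule eigenvalue_pos[OF assms])
  show 1: "l powr (1/2) * l powr (- (1/2)) = 1" and "l powr (- (1/2)) * l powr (1/2) = 1"
    using l by (simp_all flip: powr_add)
  have "l powr (- (1/2)) * (l powr (- (1/2)) * l powr 1) = 1"
    unfolding powr_add[symmetric] using l by simp
  then show "l powr (- (1/2)) * (l powr (- (1/2)) * l) = 1" using l by simp
qed

lemma bounded_linear_inv_root: "bounded_linear inv_root"
proof (rule bounded_linear_intro[where K = "c powr (- (1/2))"])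
  show "inv_root (x + y) = inv_root x + inv_root y" for x y
    by (rule eqI) (simp add: proj_inv_root linear_add[OF linear] scaleR_right_distrib)
  show "inv_root (r *\<^sub>R x) = r *\<^sub>R inv_root x" for r x
    by (rule eqI) (simp add: proj_inv_root linear_scale[OF linear])
  show "norm (inv_root x) \<le> norm x * c powr (- (1/2))" for x
    using norm_frac_pow_nonpos[of "- (1/2)" x] by (simp add: inv_root_def mult.commute)
qed

lemma inv_root_symmetric: "inner (inv_root x) y = inner x (inv_root y)"
proof (rule has_sum_unique[OF parseval_inner])
  have "((\<lambda>l. inner (P l (inv_root x)) (P l y)) has_sum inner x (inv_root y)) \<Lambda> \<longleftrightarrow>
      ((\<lambda>l. inner (P l x) (P l (inv_root y))) has_sum inner x (inv_root y)) \<Lambda>"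
    by (rule has_sum_cong) (simp add: proj_inv_root)
  then show "((\<lambda>l. inner (P l (inv_root x)) (P l y)) has_sum inner x (inv_root y)) \<Lambda>"
    using parseval_inner by simp
qed

lemma inv_root_in_V: "inv_root x \<in> V"
proof -
  have "(\<lambda>l. (l powr (1/2))\<^sup>2 * (norm (P l (inv_root x)))\<^sup>2) summable_on \<Lambda> \<longleftrightarrow>
      (\<lambda>l. (norm (P l x))\<^sup>2) summable_on \<Lambda>"
  proof (rule summable_on_cong)
    fix l assume l: "l \<in> \<Lambda>"
    have "(l powr (1/2))\<^sup>2 * (norm (P l (inv_root x)))\<^sup>2
        = (l powr (1/2) * l powr (- (1/2)))\<^sup>2 * (norm (P l x))\<^sup>2"
      using proj_inv_root[OF l] by (simp add: power_mult_distrib)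
    then show "(l powr (1/2))\<^sup>2 * (norm (P l (inv_root x)))\<^sup>2 = (norm (P l x))\<^sup>2"
      by (simp add: powr_half_cancel(1)[OF l] del: powr_half_sqrt)
  qed
  then show ?thesis using summable_norm_proj by (simp add: frac_dom_def)
qed

lemma root_inv_root: "root (inv_root x) = x"
proof (rule eqI)
  fix l assume l: "l \<in> \<Lambda>"
  have "P l (root (inv_root x)) = (l powr (1/2) * l powr (- (1/2))) *\<^sub>R P l x"
    unfolding proj_frac_pow[OF inv_root_in_V l] proj_inv_root[OF l] scaleR_scaleR ..
  then show "P l (root (inv_root x)) = P l x" unfolding powr_half_cancel(1)[OF l] by simp
qed

lemma inv_root_root: "x \<in> V \<Longrightarrow> inv_root (root x) = x"
proof (rule eqI)
  fix l assume x: "x \<in> V" and l: "l \<in> \<Lambda>"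
  have "P l (inv_root (root x)) = (l powr (- (1/2)) * l powr (1/2)) *\<^sub>R P l x"
    unfolding proj_inv_root[OF l] proj_frac_pow[OF x l] scaleR_scaleR ..
  then show "P l (inv_root (root x)) = P l x" unfolding powr_half_cancel(2)[OF l] by simp
qed

lemma inv_root_inv_root_op:
  assumes "x \<in> D" shows "inv_root (inv_root (A x)) = x"
proof (rule eqI)
  fix l assume l: "l \<in> \<Lambda>"
  have "P l (inv_root (inv_root (A x))) = (l powr (- (1/2)) * (l powr (- (1/2)) * l)) *\<^sub>R P l x"
    unfolding proj_inv_root[OF l] eigenproj_op[OF l assms] scaleR_scaleR ..
  then show "P l (inv_root (inv_root (A x))) = P l x" unfolding powr_half_cancel(3)[OF l] by simp
qed

lemma dom_subset_V: "D \<subseteq> V"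
proof
  show "x \<in> V" if "x \<in> D" for x
    using inv_root_in_V[of "inv_root (A x)"] inv_root_inv_root_op[OF that] by simp
qed

text \<open>For \<open>x = A\<^sup>-\<^sup>1\<^sup>/\<^sup>2 w\<close> one has \<open>A\<^sup>-\<^sup>1\<^sup>/\<^sup>2 x = A\<^sup>-\<^sup>1 w\<close>, which lies in \<open>D\<close>.\<close>
lemma inv_root_dom:
  assumes "x \<in> D" shows "inv_root x \<in> D"
proof -
  obtain y where y: "y \<in> D" "A y = root x" using surjective by blast
  have "inv_root (inv_root (root x)) = y" using inv_root_inv_root_op[OF y(1)] y(2) by simp
  then show ?thesis using inv_root_root[of x] assms dom_subset_V y(1) by auto
qed

lemma inv_root_op_inv_root:
  assumes "inv_root p \<in> D" shows "inv_root (A (inv_root p)) = p"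
  using arg_cong[OF inv_root_inv_root_op[OF assms], of root] by (simp only: root_inv_root)

definition of_coords :: "'h state \<Rightarrow> 'h state" where
  "of_coords = (\<lambda>(p, v, q, z). (inv_root p, v, inv_root q, z))"
definition coords :: "'h state \<Rightarrow> 'h state" where
  "coords = (\<lambda>(u, v, y, z). (root u, v, root y, z))"

abbreviation "X \<equiv> energy_space D A"
abbreviation "N \<equiv> energy_norm D A 1"

lemma energy_norm_coords: "N U = norm (coords U)"
proof -
  obtain u v y z where U: "U = (u, v, y, z)" by (rule prod_cases4)
  have "1 * (norm (root u))\<^sup>2 + (norm (root y))\<^sup>2 + (norm v)\<^sup>2 + (norm z)\<^sup>2
      = (norm (root u))\<^sup>2 + ((norm v)\<^sup>2 + ((norm (root y))\<^sup>2 + (norm z)\<^sup>2))" by linarith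
  then show ?thesis by (simp only: U energy_norm_def coords_def norm_Pair prod.case
      real_sqrt_pow2 zero_le_power2 add_nonneg_nonneg)
qed

lemma coords_of_coords: "coords (of_coords w) = w"
  by (cases w) (simp add: coords_def of_coords_def root_inv_root)

lemma of_coords_coords: "U \<in> X \<Longrightarrow> of_coords (coords U) = U"
  by (cases U) (auto simp: coords_def of_coords_def inv_root_root energy_space_def)

lemma of_coords_in_space: "of_coords w \<in> X"
  by (cases w) (simp add: of_coords_def energy_space_def inv_root_in_V)

lemma linear_of_coords: "Real_Vector_Spaces.linear of_coords"
proof -
  interpret R: bounded_linear inv_root by (rule bounded_linear_inv_root)
  show ?thesis by (rule linearI) (auto simp: of_coords_def R.add R.scaleR)
qed

lemma space_eq_range: "X = range of_coords"
proof (intro equalityI subsetI)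
  fix U assume "U \<in> X"
  then show "U \<in> range of_coords" using of_coords_coords by (intro image_eqI[of _ _ "coords U"]) simp_all
next
  fix U assume "U \<in> range of_coords"
  then show "U \<in> X" using of_coords_in_space by auto
qed

lemma subspace_space: "subspace X"
  unfolding space_eq_range by (rule linear_subspace_image[OF linear_of_coords subspace_UNIV])

lemma coords_add:
  assumes "U \<in> X" "W \<in> X" shows "coords (U + W) = coords U + coords W"
proof -
  have "U + W = of_coords (coords U + coords W)"
    using assms by (simp add: linear_add[OF linear_of_coords] of_coords_coords)
  then show ?thesis by (simp only: coords_of_coords)
qed

lemma coords_scaleR:
  assumes "U \<in> X" shows "coords (r *\<^sub>R U) = r *\<^sub>R coords U"
proof -
  have "r *\<^sub>R U = of_coords (r *\<^sub>R coords U)"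
    using assms by (simp add: linear_scale[OF linear_of_coords] of_coords_coords)
  then show ?thesis by (simp only: coords_of_coords)
qed

lemma coords_diff:
  assumes "U \<in> X" "W \<in> X" shows "coords (U - W) = coords U - coords W"
proof -
  have "U - W = of_coords (coords U - coords W)"
    using assms by (simp add: linear_diff[OF linear_of_coords] of_coords_coords)
  then show ?thesis by (simp only: coords_of_coords)
qed

lemma c0_semigroup_in_space:
  assumes "c0_semigroup X N T" "t \<ge> 0" shows "T t (of_coords w) \<in> X"
proof -
  have "T t ` X \<subseteq> X" using assms by (simp add: c0_semigroup_def)
  then show ?thesis using of_coords_in_space by blast
qed

text \<open>The coordinate map is an isometry of the energy space onto \<open>H\<^sup>4\<close>, so the semigroup and
  its generator can be transported to the Banach space \<open>H\<^sup>4\<close>.\<close>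
lemma strong_semigroup_coords:
  assumes T: "c0_semigroup X N T"
  shows "strong_semigroup (\<lambda>t w. coords (T t (of_coords w)))"
proof -
  have lin: "clinear_on X (T t)" and bdd: "\<exists>C. \<forall>U\<in>X. N (T t U) \<le> C * N U"
    if "t \<ge> 0" for t using T that by (auto simp: c0_semigroup_def)
  have T0: "T 0 U = U" if "U \<in> X" for U using T that by (simp add: c0_semigroup_def)
  have TX: "T t (of_coords w) \<in> X" if "t \<ge> 0" for t w by (rule c0_semigroup_in_space[OF T that])
  show ?thesis
  proof (rule strong_semigroup.intro)
    show "bounded_linear (\<lambda>w. coords (T t (of_coords w)))" if t: "t \<ge> 0" for t
    proof -
      obtain C where C: "\<And>U. U \<in> X \<Longrightarrow> N (T t U) \<le> C * N U" using bdd[OF t] by blast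
      show ?thesis
      proof (rule bounded_linear_intro[where K = C])
        fix w w' r
        have "T t (of_coords w + of_coords w') = T t (of_coords w) + T t (of_coords w')"
          using lin[OF t] of_coords_in_space unfolding clinear_on_def by blast
        then show "coords (T t (of_coords (w + w'))) = coords (T t (of_coords w)) + coords (T t (of_coords w'))"
          by (simp add: linear_add[OF linear_of_coords] coords_add[OF TX[OF t] TX[OF t]])
        have "T t (complex_of_real r *\<^sub>C of_coords w) = complex_of_real r *\<^sub>C T t (of_coords w)"
          using lin[OF t] of_coords_in_space unfolding clinear_on_def by blast
        then show "coords (T t (of_coords (r *\<^sub>R w))) = r *\<^sub>R coords (T t (of_coords w))"
          by (simp add: scaleC_of_real linear_scale[OF linear_of_coords] coords_scaleR[OF TX[OF t]])
        show "norm (coords (T t (of_coords w))) \<le> norm w * C"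
          using C[OF of_coords_in_space[of w]]
          by (simp add: energy_norm_coords coords_of_coords mult.commute)
      qed
    qed
    show "coords (T 0 (of_coords w)) = w" for w by (simp add: T0 of_coords_in_space coords_of_coords)
    show "coords (T (s + t) (of_coords w)) = coords (T s (of_coords (coords (T t (of_coords w)))))"
      if "s \<ge> 0" "t \<ge> 0" for s t w
      using T that TX[OF that(2)] of_coords_in_space by (simp add: c0_semigroup_def of_coords_coords)
    show "((\<lambda>t. coords (T t (of_coords w))) \<longlongrightarrow> w) (at_right 0)" for w
    proof -
      have "((\<lambda>t. N (T t (of_coords w) - of_coords w)) \<longlongrightarrow> 0) (at_right 0)"
        using T of_coords_in_space by (simp add: c0_semigroup_def)
      moreover have "\<forall>\<^sub>F t in at_right 0.
          N (T t (of_coords w) - of_coords w) = norm (coords (T t (of_coords w)) - w)"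
        using eventually_at_right_less[of 0]
        by eventually_elim
          (simp add: energy_norm_coords coords_diff TX of_coords_in_space coords_of_coords)
      ultimately have "((\<lambda>t. norm (coords (T t (of_coords w)) - w)) \<longlongrightarrow> 0) (at_right 0)"
        by (rule Lim_transform_eventually)
      then show ?thesis by (rule LIM_zero_cancel[OF tendsto_norm_zero_cancel])
    qed
  qed
qed

lemma right_derivative_coords_iff:
  assumes T: "c0_semigroup X N T"
  shows "strong_semigroup.right_derivative_at_zero (\<lambda>t w. coords (T t (of_coords w))) x y
     \<longleftrightarrow> (of_coords x, of_coords y) \<in> generator_graph X N T"
proof -
  interpret S: strong_semigroup "\<lambda>t w. coords (T t (of_coords w))"
    by (rule strong_semigroup_coords[OF T])
  have TX: "T t (of_coords w) \<in> X" if "t \<ge> 0" for t w by (rule c0_semigroup_in_space[OF T that])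
  have "\<forall>\<^sub>F h in at_right 0. N ((1 / h) *\<^sub>R (T h (of_coords x) - of_coords x) - of_coords y)
      = norm ((1 / h) *\<^sub>R (coords (T h (of_coords x)) - x) - y)"
    using eventually_at_right_less[of 0]
  proof eventually_elim
    case (elim h)
    have d: "T h (of_coords x) - of_coords x \<in> X"
      using subspace_diff[OF subspace_space TX of_coords_in_space] elim by simp
    then have d': "(1 / h) *\<^sub>R (T h (of_coords x) - of_coords x) \<in> X"
      using subspace_scale[OF subspace_space] by blast
    show ?case
      unfolding energy_norm_coords
      unfolding coords_diff[OF d' of_coords_in_space] coords_scaleR[OF d]
      using elim by (simp add: coords_diff TX of_coords_in_space coords_of_coords)
  qed
  then have "((\<lambda>h. N ((1 / h) *\<^sub>R (T h (of_coords x) - of_coords x) - of_coords y)) \<longlongrightarrow> 0) (at_right 0)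
      \<longleftrightarrow> ((\<lambda>h. norm ((1 / h) *\<^sub>R (coords (T h (of_coords x)) - x) - y)) \<longlongrightarrow> 0) (at_right 0)"
    by (rule filterlim_cong[OF refl refl])
  also have "\<dots> \<longleftrightarrow> S.right_derivative_at_zero x y"
    unfolding S.right_derivative_at_zero_def tendsto_norm_zero_iff by (rule LIM_zero_iff)
  finally show ?thesis by (simp add: generator_graph_def of_coords_in_space)
qed

lemma exponential_stability:
  assumes T: "semigroup_generated_by X N (system_dom D A) (system_op D A 1 0 \<alpha>) T"
    and \<alpha>: "\<alpha> \<noteq> 0"
  shows "\<exists>M>0. \<exists>\<epsilon>>0. \<forall>t>0. \<forall>U0\<in>X. N (T t U0) \<le> M * exp (- \<epsilon> * t) * N U0"
proof -
  define S where "S t w = coords (T t (of_coords w))" for t w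
  have c0: "c0_semigroup X N T"
    and gen: "generator_graph X N T = (\<lambda>U. (U, system_op D A 1 0 \<alpha> U)) ` system_dom D A"
    using T by (auto simp: semigroup_generated_by_def)
  have S: "strong_semigroup S"
    using strong_semigroup_coords[OF c0] unfolding S_def .
  have deriv_iff: "strong_semigroup.right_derivative_at_zero S x y \<longleftrightarrow>
      of_coords x \<in> system_dom D A \<and> of_coords y = system_op D A 1 0 \<alpha> (of_coords x)" for x y
    using right_derivative_coords_iff[OF c0, of x y] unfolding S_def gen by auto
  have bound: "norm (inv_root x) \<le> c powr (- (1/2)) * norm x" for x
    using norm_frac_pow_nonpos[of "- (1/2)" x] by (simp add: inv_root_def)
  obtain J m \<omega> where J: "bounded_linear J" "\<And>w w'. inner (J w) w' = inner w (J w')"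
    "m > 0" "\<And>w. m * (norm w)\<^sup>2 \<le> inner (J w) w" "\<omega> > 0"
    and diss: "\<And>p v q z f g y1 y3. inv_root y1 = v \<Longrightarrow> inv_root y3 = z \<Longrightarrow>
       inv_root f = p \<Longrightarrow> inv_root g = q \<Longrightarrow>
       2 * inner (J (p, v, q, z)) (y1, - f - v - \<alpha> *\<^sub>R z, y3, - g + \<alpha> *\<^sub>R v)
       \<le> - (\<omega> * inner (J (p, v, q, z)) (p, v, q, z))"
    by (rule lyapunov_functional[OF bounded_linear_inv_root inv_root_symmetric bound _ \<alpha>]) auto
  have "\<exists>M>0. \<exists>\<epsilon>>0. \<forall>t\<ge>0. \<forall>x. norm (S t x) \<le> M * exp (- \<epsilon> * t) * norm x"
  proof (rule lyapunov_exponential_decay[OF S J])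
    fix x y assume "strong_semigroup.right_derivative_at_zero S x y"
    then have dom: "of_coords x \<in> system_dom D A" and eq: "of_coords y = system_op D A 1 0 \<alpha> (of_coords x)"
      by (auto simp: deriv_iff)
    obtain p v q z where x: "x = (p, v, q, z)" by (rule prod_cases4)
    obtain y1 y2 y3 y4 where y: "y = (y1, y2, y3, y4)" by (rule prod_cases4)
    have p: "inv_root (A (inv_root p)) = p" and q: "inv_root (A (inv_root q)) = q"
      using dom by (auto simp: x of_coords_def system_dom_def intro: inv_root_op_inv_root)
    have "inv_root y1 = v" "inv_root y3 = z"
        "y2 = - A (inv_root p) - v - \<alpha> *\<^sub>R z" "y4 = - A (inv_root q) + \<alpha> *\<^sub>R v"
      using eq by (auto simp: x y of_coords_def system_op_def frac_pow_zero)
    then show "2 * inner (J x) y \<le> - (\<omega> * inner (J x) x)"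
      using diss[OF _ _ p q] by (simp add: x y)
  next
    \<comment> \<open>in coordinates the domain of the generator contains \<open>D\<^sup>4\<close>, which is dense\<close>
    have "D \<times> D \<times> D \<times> D \<subseteq> {x. \<exists>y. strong_semigroup.right_derivative_at_zero S x y}"
    proof
      fix x assume "x \<in> D \<times> D \<times> D \<times> D"
      then obtain p v q z where x: "x = (p, v, q, z)" and D: "p \<in> D" "v \<in> D" "q \<in> D" "z \<in> D"
        by auto
      then have "of_coords x \<in> system_dom D A"
        using dom_subset_V
        by (auto simp: of_coords_def system_dom_def energy_space_def inv_root_dom inv_root_in_V)
      moreover have "system_op D A 1 0 \<alpha> (of_coords x) \<in> X"
        using D dom_subset_V by (auto simp: x of_coords_def system_op_def energy_space_def)
      ultimately have "strong_semigroup.right_derivative_at_zero S x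
          (coords (system_op D A 1 0 \<alpha> (of_coords x)))"
        by (simp add: deriv_iff of_coords_coords)
      then show "x \<in> {x. \<exists>y. strong_semigroup.right_derivative_at_zero S x y}" by blast
    qed
    then have "closure (D \<times> D \<times> D \<times> D)
        \<subseteq> closure {x. \<exists>y. strong_semigroup.right_derivative_at_zero S x y}"
      by (rule closure_mono)
    then show "closure {x. \<exists>y. strong_semigroup.right_derivative_at_zero S x y} = UNIV"
      by (simp add: closure_Times dense_dom top.extremum_unique)
  qed
  then obtain M \<epsilon> where "M > 0" "\<epsilon> > 0"
    and decay: "\<forall>t\<ge>0. \<forall>x. norm (S t x) \<le> M * exp (- \<epsilon> * t) * norm x"
    by blast
  moreover have "N (T t U) \<le> M * exp (- \<epsilon> * t) * N U" if "t > 0" "U \<in> X" for t U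
    using decay[rule_format, of t "coords U"] that
    by (simp add: S_def energy_norm_coords of_coords_coords)
  ultimately show ?thesis by blast
qed

end

theorem theorem3p1:
  fixes D :: "'h::complex_hilbert set" and A :: "'h \<Rightarrow> 'h"
    and a \<gamma> \<alpha> :: real and T :: "real \<Rightarrow> 'h state \<Rightarrow> 'h state"
  assumes infinite_dimensional: "\<forall>B::'h set. finite B \<longrightarrow> cspan B \<noteq> UNIV"
    and separable: "separable_space (euclidean :: 'h topology)"
    and "self_adjoint D A" and "coercive D A"
    and "compact_resolvent D A" and "simple_spectrum D A"
    and "a > 0" and "\<gamma> \<le> 0" and "\<alpha> \<noteq> 0"
    and semigroup: "semigroup_generated_by (energy_space D A) (energy_norm D A a)
           (system_dom D A) (system_op D A a \<gamma> \<alpha>) T"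
    and "a = 1" and "\<gamma> = 0"
  shows "\<exists>M>0. \<exists>\<epsilon>>0. \<forall>t>0. \<forall>U0\<in>energy_space D A.
           energy_norm D A a (T t U0) \<le> M * exp (- \<epsilon> * t) * energy_norm D A a U0"
proof -
  obtain c where c: "c > 0" "\<And>x. x \<in> D \<Longrightarrow> c * (norm x)\<^sup>2 \<le> inner (A x) x"
    using \<open>coercive D A\<close> unfolding coercive_def Re_cinner by blast
  interpret coercive_operator D A c
    by (rule coercive_operator.intro)
      (fact \<open>self_adjoint D A\<close> \<open>compact_resolvent D A\<close> \<open>simple_spectrum D A\<close> c)+
  have "semigroup_generated_by X N (system_dom D A) (system_op D A 1 0 \<alpha>) T"
    using semigroup unfolding \<open>a = 1\<close> \<open>\<gamma> = 0\<close> .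
  from exponential_stability[OF this \<open>\<alpha> \<noteq> 0\<close>] show ?thesis
    unfolding \<open>a = 1\<close> .
qed

end
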